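(* Let $S$ be a semigroup with identity. If $\ell^1(S)$ is Johnson pseudo-contractible, then $S$ is regular and the set $E_S$ of idempotents of $S$ is finite.
   Context: $\ell^1(S)$ is the complex Banach algebra of absolutely summable functions on $S$ with the $\ell^1$-norm and convolution product (determined by $\delta_s*\delta_t=\delta_{st}$). A semigroup $S$ is regular if for each $s\in S$ there is $t\in S$ with $sts=s$ and $tst=t$. $E_S$ denotes the set of idempotents of $S$. For a Banach algebra $A$, let $A\otimes_p A$ be the (completed) projective tensor product, a Banach $A$-bimodule with actions determined by $a\cdot(b\otimes c)=ab\otimes c$ and $(b\otimes c)\cdot a=b\otimes ca$, and let $\pi_A:A\otimes_p A\to A$ be the bounded linear map determined by $\pi_A(a\otimes b)=ab$. The biduals $A^{**}$ and $(A\otimes_p A)^{**}$ carry the induced bidual $A$-bimodule structures, and $A$ is regarded as canonically embedded in $A^{**}$. $A$ is called Johnson pseudo-contractible if there is a (not necessarily bounded) net $(m_\alpha)$ in $(A\otimes_p A)^{**}$ such that $a\cdot m_\alpha=m_\alpha\cdot a$ for all $\alpha$ and $\pi_A^{**}(m_\alpha)a-a\to 0$ in norm, for every $a\in A$. *)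

theory Defs
  imports "HOL-Analysis.Analysis"
begin

section \<open>Complex Banach spaces and algebras\<close>

text \<open>
  The complex scalar action extends the real one, so that the topology, limits and real-linear
  operators of HOL-Analysis apply unchanged.
\<close>

class complex_normed_vector = real_normed_vector +
  fixes scaleC :: "complex \<Rightarrow> 'a \<Rightarrow> 'a"  (infixr \<open>*\<^sub>C\<close> 75)
  assumes scaleC_add_right: "c *\<^sub>C (x + y) = c *\<^sub>C x + c *\<^sub>C y"
    and scaleC_add_left: "(c + d) *\<^sub>C x = c *\<^sub>C x + d *\<^sub>C x"
    and scaleC_scaleC [simp]: "c *\<^sub>C (d *\<^sub>C x) = (c * d) *\<^sub>C x"
    and scaleC_of_real: "of_real r *\<^sub>C x = r *\<^sub>R x"
    and norm_scaleC [simp]: "norm (c *\<^sub>C x) = norm c * norm x"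

class complex_banach = complex_normed_vector + complete_space

text \<open>Banach algebras are not required to have a unit.\<close>

class complex_banach_algebra = complex_banach + real_normed_algebra +
  assumes mult_scaleC_left: "(c *\<^sub>C x) * y = c *\<^sub>C (x * y)"
    and mult_scaleC_right: "x * (c *\<^sub>C y) = c *\<^sub>C (x * y)"

instance complex_banach \<subseteq> banach ..

lemma scaleC_one [simp]: "1 *\<^sub>C (x::'a::complex_normed_vector) = x"
  using scaleC_of_real[of 1 x] by simp

lemma scaleC_zero_left [simp]: "0 *\<^sub>C (x::'a::complex_normed_vector) = 0"
  using scaleC_of_real[of 0 x] by simp

lemma scaleC_zero_right [simp]: "c *\<^sub>C (0::'a::complex_normed_vector) = 0"
  using scaleC_add_right[of c 0 0] by simp

lemma scaleC_minus_right [simp]: "c *\<^sub>C (- x) = - (c *\<^sub>C (x::'a::complex_normed_vector))"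
  using scaleC_add_right[of c x "-x"] by (simp add: minus_unique)

lemma scaleC_diff_right: "c *\<^sub>C (x - y) = c *\<^sub>C x - c *\<^sub>C (y::'a::complex_normed_vector)"
  using scaleC_add_right[of c x "-y"] by simp

lemma scaleC_commute: "c *\<^sub>C d *\<^sub>C x = d *\<^sub>C c *\<^sub>C (x::'a::complex_normed_vector)"
  by (simp add: mult.commute)

lemma scaleR_scaleC: "r *\<^sub>R c *\<^sub>C x = c *\<^sub>C r *\<^sub>R (x::'a::complex_normed_vector)"
  by (metis scaleC_of_real scaleC_commute)

lemma scaleC_sum_right: "c *\<^sub>C (\<Sum>i\<in>I. f i) = (\<Sum>i\<in>I. c *\<^sub>C (f i::'a::complex_normed_vector))"
  by (induction I rule: infinite_finite_induct) (auto simp: scaleC_add_right)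

lemma bounded_linear_scaleC_right: "bounded_linear (\<lambda>x::'a::complex_normed_vector. c *\<^sub>C x)"
  by (rule bounded_linear_intro[where K = "norm c"]) (auto simp: scaleC_add_right scaleR_scaleC)

lemma bounded_linear_scaleC_left: "bounded_linear (\<lambda>c. c *\<^sub>C (x::'a::complex_normed_vector))"
proof (rule bounded_linear_intro[where K = "norm x"])
  show "(r *\<^sub>R c) *\<^sub>C x = r *\<^sub>R c *\<^sub>C x" for r c
    by (metis scaleC_of_real scaleC_scaleC scaleR_conv_of_real)
qed (auto simp: scaleC_add_left)

instantiation complex :: complex_banach_algebra
begin

definition scaleC_complex :: "complex \<Rightarrow> complex \<Rightarrow> complex" where
  "scaleC_complex c x = c * x"

instance
  by standard (auto simp: scaleC_complex_def algebra_simps norm_mult scaleR_conv_of_real)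

end


section \<open>Bounded complex-linear operators, dual spaces and adjoints\<close>

definition bounded_clinear :: "('a::complex_normed_vector \<Rightarrow> 'b::complex_normed_vector) \<Rightarrow> bool" where
  "bounded_clinear f \<longleftrightarrow> bounded_linear f \<and> (\<forall>c x. f (c *\<^sub>C x) = c *\<^sub>C f x)"

lemma bounded_clinearI:
  assumes "\<And>x y. f (x + y) = f x + f y" "\<And>c x. f (c *\<^sub>C x) = c *\<^sub>C f x"
    and "\<And>x. norm (f x) \<le> K * norm x"
  shows "bounded_clinear f"
  unfolding bounded_clinear_def
proof (intro conjI allI)
  show "bounded_linear f"
    using assms(1,3) by (intro bounded_linear_intro[where K = K])
      (auto simp: mult.commute, metis assms(2) scaleC_of_real)
qed (fact assms(2))

lemma bounded_clinear_bounded_linear: "bounded_clinear f \<Longrightarrow> bounded_linear f"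
  by (simp add: bounded_clinear_def)

lemma bounded_clinear_zero: "bounded_clinear (\<lambda>_. 0)"
  by (simp add: bounded_clinear_def bounded_linear_zero)

lemma bounded_clinear_add: "bounded_clinear f \<Longrightarrow> bounded_clinear g \<Longrightarrow> bounded_clinear (\<lambda>x. f x + g x)"
  by (auto simp: bounded_clinear_def bounded_linear_add scaleC_add_right)

lemma bounded_clinear_uminus: "bounded_clinear f \<Longrightarrow> bounded_clinear (\<lambda>x. - f x)"
  by (auto simp: bounded_clinear_def bounded_linear_minus)

lemma bounded_clinear_diff: "bounded_clinear f \<Longrightarrow> bounded_clinear g \<Longrightarrow> bounded_clinear (\<lambda>x. f x - g x)"
  by (auto simp: bounded_clinear_def bounded_linear_sub scaleC_diff_right)

lemma bounded_clinear_scaleR: "bounded_clinear f \<Longrightarrow> bounded_clinear (\<lambda>x. r *\<^sub>R f x)"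
  by (auto simp: bounded_clinear_def bounded_linear_const_scaleR scaleR_scaleC)

lemma bounded_clinear_scaleC: "bounded_clinear f \<Longrightarrow> bounded_clinear (\<lambda>x. c *\<^sub>C f x)"
  by (auto simp: bounded_clinear_def mult.commute intro: bounded_linear_compose[OF bounded_linear_scaleC_right])

lemma bounded_clinear_compose: "bounded_clinear f \<Longrightarrow> bounded_clinear g \<Longrightarrow> bounded_clinear (\<lambda>x. f (g x))"
  by (auto simp: bounded_clinear_def intro: bounded_linear_compose)

typedef (overloaded) ('a, 'b) cblinfun  (\<open>(_ \<Rightarrow>\<^sub>C\<^sub>L /_)\<close> [22, 21] 21) =
  "{f :: 'a::complex_normed_vector \<Rightarrow> 'b::complex_normed_vector. bounded_clinear f}"
  morphisms cblinfun_apply CBlinfun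
  using bounded_clinear_zero by blast

declare [[coercion "cblinfun_apply :: ('a::complex_normed_vector \<Rightarrow>\<^sub>C\<^sub>L 'b::complex_normed_vector) \<Rightarrow> 'a \<Rightarrow> 'b"]]

lemma bounded_clinear_cblinfun_apply: "bounded_clinear (cblinfun_apply T)"
  using cblinfun_apply by auto

lemma bounded_linear_cblinfun_apply: "bounded_linear (cblinfun_apply T)"
  by (rule bounded_clinear_bounded_linear[OF bounded_clinear_cblinfun_apply])

lemma CBlinfun_apply: "bounded_clinear f \<Longrightarrow> cblinfun_apply (CBlinfun f) = f"
  by (simp add: CBlinfun_inverse)

lemma cblinfun_eqI: "(\<And>x. cblinfun_apply S x = cblinfun_apply T x) \<Longrightarrow> S = T"
  by (simp add: cblinfun_apply_inject[symmetric] ext)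

setup_lifting type_definition_cblinfun

instantiation cblinfun :: (complex_normed_vector, complex_normed_vector) complex_normed_vector
begin

lift_definition norm_cblinfun :: "'a \<Rightarrow>\<^sub>C\<^sub>L 'b \<Rightarrow> real" is onorm .
lift_definition zero_cblinfun :: "'a \<Rightarrow>\<^sub>C\<^sub>L 'b" is "\<lambda>_. 0" by (rule bounded_clinear_zero)
lift_definition plus_cblinfun :: "'a \<Rightarrow>\<^sub>C\<^sub>L 'b \<Rightarrow> 'a \<Rightarrow>\<^sub>C\<^sub>L 'b \<Rightarrow> 'a \<Rightarrow>\<^sub>C\<^sub>L 'b" is "\<lambda>f g x. f x + g x"
  by (rule bounded_clinear_add)
lift_definition minus_cblinfun :: "'a \<Rightarrow>\<^sub>C\<^sub>L 'b \<Rightarrow> 'a \<Rightarrow>\<^sub>C\<^sub>L 'b \<Rightarrow> 'a \<Rightarrow>\<^sub>C\<^sub>L 'b" is "\<lambda>f g x. f x - g x"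
  by (rule bounded_clinear_diff)
lift_definition uminus_cblinfun :: "'a \<Rightarrow>\<^sub>C\<^sub>L 'b \<Rightarrow> 'a \<Rightarrow>\<^sub>C\<^sub>L 'b" is "\<lambda>f x. - f x"
  by (rule bounded_clinear_uminus)
lift_definition scaleR_cblinfun :: "real \<Rightarrow> 'a \<Rightarrow>\<^sub>C\<^sub>L 'b \<Rightarrow> 'a \<Rightarrow>\<^sub>C\<^sub>L 'b" is "\<lambda>r f x. r *\<^sub>R f x"
  by (rule bounded_clinear_scaleR)
lift_definition scaleC_cblinfun :: "complex \<Rightarrow> 'a \<Rightarrow>\<^sub>C\<^sub>L 'b \<Rightarrow> 'a \<Rightarrow>\<^sub>C\<^sub>L 'b" is "\<lambda>c f x. c *\<^sub>C f x"
  by (rule bounded_clinear_scaleC)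

definition dist_cblinfun :: "'a \<Rightarrow>\<^sub>C\<^sub>L 'b \<Rightarrow> 'a \<Rightarrow>\<^sub>C\<^sub>L 'b \<Rightarrow> real" where
  "dist_cblinfun S T = norm (S - T)"
definition sgn_cblinfun :: "'a \<Rightarrow>\<^sub>C\<^sub>L 'b \<Rightarrow> 'a \<Rightarrow>\<^sub>C\<^sub>L 'b" where
  "sgn_cblinfun T = inverse (norm T) *\<^sub>R T"
definition [code del]:
  "(uniformity :: (('a \<Rightarrow>\<^sub>C\<^sub>L 'b) \<times> ('a \<Rightarrow>\<^sub>C\<^sub>L 'b)) filter) = (INF e\<in>{0 <..}. principal {(x, y). dist x y < e})"
definition open_cblinfun :: "('a \<Rightarrow>\<^sub>C\<^sub>L 'b) set \<Rightarrow> bool" where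
  [code del]: "open_cblinfun S = (\<forall>x\<in>S. \<forall>\<^sub>F (x', y) in uniformity. x' = x \<longrightarrow> y \<in> S)"

instance
proof
  fix S T U :: "'a \<Rightarrow>\<^sub>C\<^sub>L 'b" and r s :: real and c d :: complex
  show "norm (S + T) \<le> norm S + norm T"
    by transfer (auto intro: onorm_triangle bounded_clinear_bounded_linear)
  show "norm (r *\<^sub>R S) = \<bar>r\<bar> * norm S"
    by transfer (auto intro: onorm_scaleR bounded_clinear_bounded_linear)
  show "norm S = 0 \<longleftrightarrow> S = 0"
    by transfer (auto simp: onorm_eq_0 bounded_clinear_bounded_linear fun_eq_iff)
  show "norm (c *\<^sub>C S) = norm c * norm S"
  proof transfer
    fix c :: complex and f :: "'a \<Rightarrow> 'b"
    assume "bounded_clinear f"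
    then have "bounded_linear (\<lambda>x. norm c *\<^sub>R f x)" and f: "bounded_linear f"
      by (auto intro: bounded_linear_const_scaleR bounded_clinear_bounded_linear)
    have "onorm (\<lambda>x. c *\<^sub>C f x) = onorm (\<lambda>x. norm c *\<^sub>R f x)"
      by (simp add: onorm_def)
    also have "\<dots> = norm c * onorm f"
      using onorm_scaleR[OF f] by simp
    finally show "onorm (\<lambda>x. c *\<^sub>C f x) = norm c * onorm f" .
  qed
qed ((simp only: dist_cblinfun_def sgn_cblinfun_def uniformity_cblinfun_def open_cblinfun_def)
   | (transfer, simp add: fun_eq_iff scaleR_add_left scaleR_add_right scaleC_add_left scaleC_add_right
        scaleC_of_real add.assoc))+

end

lemma norm_cblinfun: "norm (cblinfun_apply T x) \<le> norm T * norm x"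
  by transfer (rule onorm[OF bounded_clinear_bounded_linear])

lemma norm_cblinfun_bound: "0 \<le> b \<Longrightarrow> (\<And>x. norm (cblinfun_apply T x) \<le> b * norm x) \<Longrightarrow> norm T \<le> b"
  by transfer (rule onorm_bound)

lemma norm_CBlinfun_bound:
  assumes "bounded_clinear f" "0 \<le> b" "\<And>x. norm (f x) \<le> b * norm x"
  shows "norm (CBlinfun f) \<le> b"
  using assms by (intro norm_cblinfun_bound) (auto simp: CBlinfun_apply)

lemma cblinfun_apply_add [simp]: "cblinfun_apply T (x + y) = cblinfun_apply T x + cblinfun_apply T y"
  by (rule linear_add[OF bounded_linear.linear[OF bounded_linear_cblinfun_apply]])

lemma cblinfun_apply_scaleC [simp]: "cblinfun_apply T (c *\<^sub>C x) = c *\<^sub>C cblinfun_apply T x"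
  using bounded_clinear_cblinfun_apply by (auto simp: bounded_clinear_def)

lemma cblinfun_add_apply [simp]: "cblinfun_apply (S + T) x = cblinfun_apply S x + cblinfun_apply T x"
  by transfer simp

lemma cblinfun_scaleC_apply [simp]: "cblinfun_apply (c *\<^sub>C S) x = c *\<^sub>C cblinfun_apply S x"
  by transfer simp

type_synonym 'a cdual = "'a \<Rightarrow>\<^sub>C\<^sub>L complex"

definition cadjoint ::
  "('a::complex_normed_vector \<Rightarrow>\<^sub>C\<^sub>L 'b::complex_normed_vector) \<Rightarrow> 'b cdual \<Rightarrow>\<^sub>C\<^sub>L 'a cdual" where
  "cadjoint T = CBlinfun (\<lambda>f::'b cdual. CBlinfun (\<lambda>x. f (T x)))"

lemma cadjoint_apply [simp]: "cblinfun_apply (cblinfun_apply (cadjoint T) f) x = cblinfun_apply f (cblinfun_apply T x)"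
proof -
  have 1: "bounded_clinear (\<lambda>x. cblinfun_apply f (cblinfun_apply T x))" for f :: "'b cdual"
    by (rule bounded_clinear_compose[OF bounded_clinear_cblinfun_apply bounded_clinear_cblinfun_apply])
  have "bounded_clinear (\<lambda>f::'b cdual. CBlinfun (\<lambda>x. f (T x)))"
  proof (rule bounded_clinearI[where K = "norm T"])
    fix f :: "'b cdual"
    show "norm (CBlinfun (\<lambda>x. f (T x))) \<le> norm T * norm f"
    proof (rule norm_CBlinfun_bound[OF 1])
      fix x
      have "norm (f (T x)) \<le> norm f * norm (T x)" by (rule norm_cblinfun)
      also have "\<dots> \<le> norm f * (norm T * norm x)"
        by (intro mult_left_mono norm_cblinfun) auto
      finally show "norm (f (T x)) \<le> norm T * norm f * norm x" by (simp add: ac_simps)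
    qed auto
  qed (auto intro!: cblinfun_eqI simp: CBlinfun_apply 1 bounded_clinear_add bounded_clinear_scaleC)
  then show ?thesis
    by (simp add: cadjoint_def CBlinfun_apply 1)
qed

definition canonical_embedding :: "'a::complex_normed_vector \<Rightarrow> 'a cdual cdual" where
  "canonical_embedding x = CBlinfun (\<lambda>f::'a cdual. f x)"

lemma canonical_embedding_apply [simp]:
  "cblinfun_apply (canonical_embedding x) f = cblinfun_apply f x"
proof -
  have "bounded_clinear (\<lambda>f::'a cdual. f x)"
    by (rule bounded_clinearI[where K = "norm x"]) (use norm_cblinfun in \<open>auto simp: mult.commute\<close>)
  then show ?thesis
    by (simp add: canonical_embedding_def CBlinfun_apply)
qed

section \<open>The space of absolutely summable functions\<close>

typedef 'a ell1 = "{f :: 'a \<Rightarrow> complex. (\<lambda>x. norm (f x)) summable_on UNIV}"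
  morphisms ell1_apply Ell1
  by (rule exI[of _ "\<lambda>_. 0"]) simp

setup_lifting type_definition_ell1

lemma ell1_summable_norm: "(\<lambda>x. norm (ell1_apply u x)) summable_on A"
  using ell1_apply[of u] by (auto intro: summable_on_subset_banach[where A = UNIV])

lemma ell1_apply_Ell1: "(\<lambda>x. norm (f x)) summable_on UNIV \<Longrightarrow> ell1_apply (Ell1 f) = f"
  by (simp add: Ell1_inverse)

lemma ell1_eqI: "(\<And>x. ell1_apply u x = ell1_apply v x) \<Longrightarrow> u = v"
  by (simp add: ell1_apply_inject[symmetric] ext)

lemma abs_summable_add:
  fixes f g :: "'a \<Rightarrow> complex"
  assumes "(\<lambda>x. norm (f x)) summable_on A" "(\<lambda>x. norm (g x)) summable_on A"
  shows "(\<lambda>x. norm (f x + g x)) summable_on A"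
proof (rule summable_on_comparison_test[OF summable_on_add[OF assms]])
  show "norm (f x + g x) \<le> norm (f x) + norm (g x)" for x
    by (rule norm_triangle_ineq)
qed simp

lemma abs_summable_diff:
  fixes f g :: "'a \<Rightarrow> complex"
  assumes "(\<lambda>x. norm (f x)) summable_on A" "(\<lambda>x. norm (g x)) summable_on A"
  shows "(\<lambda>x. norm (f x - g x)) summable_on A"
proof -
  have "(\<lambda>x. norm (f x + - g x)) summable_on A"
    by (rule abs_summable_add) (simp_all only: norm_minus_cancel assms)
  then show ?thesis
    by (simp only: add_uminus_conv_diff)
qed

instantiation ell1 :: (type) complex_normed_vector
begin

lift_definition norm_ell1 :: "'a ell1 \<Rightarrow> real" is "\<lambda>f. \<Sum>\<^sub>\<infinity>x. norm (f x)" .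
lift_definition zero_ell1 :: "'a ell1" is "\<lambda>_. 0" by simp
lift_definition plus_ell1 :: "'a ell1 \<Rightarrow> 'a ell1 \<Rightarrow> 'a ell1" is "\<lambda>f g x. f x + g x"
  by (rule abs_summable_add)
lift_definition minus_ell1 :: "'a ell1 \<Rightarrow> 'a ell1 \<Rightarrow> 'a ell1" is "\<lambda>f g x. f x - g x"
  by (rule abs_summable_diff)
lift_definition uminus_ell1 :: "'a ell1 \<Rightarrow> 'a ell1" is "\<lambda>f x. - f x" by simp
lift_definition scaleR_ell1 :: "real \<Rightarrow> 'a ell1 \<Rightarrow> 'a ell1" is "\<lambda>r f x. r *\<^sub>R f x"
  by (auto intro: summable_on_cmult_right)
lift_definition scaleC_ell1 :: "complex \<Rightarrow> 'a ell1 \<Rightarrow> 'a ell1" is "\<lambda>c f x. c * f x"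
  by (auto simp: norm_mult intro: summable_on_cmult_right)

definition dist_ell1 :: "'a ell1 \<Rightarrow> 'a ell1 \<Rightarrow> real" where
  "dist_ell1 u v = norm (u - v)"
definition sgn_ell1 :: "'a ell1 \<Rightarrow> 'a ell1" where
  "sgn_ell1 u = inverse (norm u) *\<^sub>R u"
definition [code del]:
  "(uniformity :: ('a ell1 \<times> 'a ell1) filter) = (INF e\<in>{0 <..}. principal {(x, y). dist x y < e})"
definition open_ell1 :: "'a ell1 set \<Rightarrow> bool" where
  [code del]: "open_ell1 S = (\<forall>x\<in>S. \<forall>\<^sub>F (x', y) in uniformity. x' = x \<longrightarrow> y \<in> S)"

instance
proof
  fix u v :: "'a ell1" and r :: real and c :: complex
  show "norm (u + v) \<le> norm u + norm v"
  proof transfer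
    fix f g :: "'a \<Rightarrow> complex"
    assume *: "(\<lambda>x. norm (f x)) summable_on UNIV" "(\<lambda>x. norm (g x)) summable_on UNIV"
    have "(\<Sum>\<^sub>\<infinity>x. norm (f x + g x)) \<le> (\<Sum>\<^sub>\<infinity>x. norm (f x) + norm (g x))"
      by (intro infsum_mono abs_summable_add summable_on_add * norm_triangle_ineq)
    also have "\<dots> = (\<Sum>\<^sub>\<infinity>x. norm (f x)) + (\<Sum>\<^sub>\<infinity>x. norm (g x))"
      by (intro infsum_add *)
    finally show "(\<Sum>\<^sub>\<infinity>x. norm (f x + g x)) \<le> (\<Sum>\<^sub>\<infinity>x. norm (f x)) + (\<Sum>\<^sub>\<infinity>x. norm (g x))" .
  qed
  show "norm (r *\<^sub>R u) = \<bar>r\<bar> * norm u"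
    by transfer (simp add: infsum_cmult_right')
  show "norm (c *\<^sub>C u) = norm c * norm u"
    by transfer (simp add: norm_mult infsum_cmult_right')
  show "norm u = 0 \<longleftrightarrow> u = 0"
  proof transfer
    fix f :: "'a \<Rightarrow> complex"
    assume "(\<lambda>x. norm (f x)) summable_on UNIV"
    note s = this
    show "(\<Sum>\<^sub>\<infinity>x. norm (f x)) = 0 \<longleftrightarrow> f = (\<lambda>_. 0)"
    proof
      assume "(\<Sum>\<^sub>\<infinity>x. norm (f x)) = 0"
      then have "norm (f x) = 0" for x
        by (intro nonneg_infsum_le_0D[OF _ s]) simp_all
      then show "f = (\<lambda>_. 0)"
        by (simp add: fun_eq_iff)
    qed simp
  qed
qed ((simp only: dist_ell1_def sgn_ell1_def uniformity_ell1_def open_ell1_def)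
   | (transfer, simp add: fun_eq_iff ring_distribs scaleR_conv_of_real add.assoc mult.assoc))+

end

lemma ell1_apply_zero [simp]: "ell1_apply 0 x = 0"
  and ell1_apply_add [simp]: "ell1_apply (u + v) x = ell1_apply u x + ell1_apply v x"
  and ell1_apply_diff [simp]: "ell1_apply (u - v) x = ell1_apply u x - ell1_apply v x"
  and ell1_apply_scaleC [simp]: "ell1_apply (c *\<^sub>C u) x = c * ell1_apply u x"
  by (transfer; simp)+

lemma norm_ell1_finite: "finite F \<Longrightarrow> (\<Sum>x\<in>F. norm (ell1_apply u x)) \<le> norm u"
  unfolding norm_ell1.rep_eq by (rule finite_sum_le_infsum) (auto intro: ell1_summable_norm)

lemma norm_ell1_apply: "norm (ell1_apply u x) \<le> norm u"
  using norm_ell1_finite[of "{x}" u] by simp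

lemma norm_ell1_bound:
  assumes "\<And>F. finite F \<Longrightarrow> (\<Sum>x\<in>F. norm (ell1_apply u x)) \<le> b"
  shows "norm u \<le> b"
  unfolding norm_ell1.rep_eq
  by (rule infsum_le_finite_sums) (use assms in \<open>auto intro: ell1_summable_norm\<close>)

instance ell1 :: (type) complex_banach
proof
  fix X :: "nat \<Rightarrow> 'a ell1"
  assume X: "Cauchy X"
  have C: "Cauchy (\<lambda>n. ell1_apply (X n) x)" for x
  proof (rule CauchyI)
    fix e :: real
    assume "e > 0"
    with CauchyD[OF X this] obtain M where M: "\<And>m n. m \<ge> M \<Longrightarrow> n \<ge> M \<Longrightarrow> norm (X m - X n) < e"
      by blast
    show "\<exists>M. \<forall>m\<ge>M. \<forall>n\<ge>M. norm (ell1_apply (X m) x - ell1_apply (X n) x) < e"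
    proof (intro exI[of _ M] allI impI)
      fix m n assume "m \<ge> M" "n \<ge> M"
      then have "norm (X m - X n) < e" by (rule M)
      with norm_ell1_apply[of "X m - X n" x]
      show "norm (ell1_apply (X m) x - ell1_apply (X n) x) < e" by simp
    qed
  qed
  define f where "f x = lim (\<lambda>n. ell1_apply (X n) x)" for x
  have f: "(\<lambda>n. ell1_apply (X n) x) \<longlonglongrightarrow> f x" for x
    using Cauchy_convergent[OF C[of x]] by (simp add: f_def convergent_LIMSEQ_iff)
  have fin: "(\<Sum>x\<in>F. norm (ell1_apply (X m) x - f x)) \<le> e"
    if M: "\<And>n. n \<ge> M \<Longrightarrow> norm (X m - X n) \<le> e" and F: "finite F" for M m e F
  proof (rule tendsto_upperbound)
    show "(\<lambda>n. \<Sum>x\<in>F. norm (ell1_apply (X m) x - ell1_apply (X n) x))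
            \<longlonglongrightarrow> (\<Sum>x\<in>F. norm (ell1_apply (X m) x - f x))"
      by (intro tendsto_intros f)
    show "\<forall>\<^sub>F n in sequentially. (\<Sum>x\<in>F. norm (ell1_apply (X m) x - ell1_apply (X n) x)) \<le> e"
    proof (rule eventually_sequentiallyI[of M])
      fix n assume "n \<ge> M"
      then have "norm (X m - X n) \<le> e" by (rule M)
      with norm_ell1_finite[OF F, of "X m - X n"]
      show "(\<Sum>x\<in>F. norm (ell1_apply (X m) x - ell1_apply (X n) x)) \<le> e" by simp
    qed
  qed auto
  have *: "\<exists>M. \<forall>m\<ge>M. \<forall>F. finite F \<longrightarrow> (\<Sum>x\<in>F. norm (ell1_apply (X m) x - f x)) \<le> e" if "e > 0" for e
  proof -
    from CauchyD[OF X that] obtain M where "\<And>m n. m \<ge> M \<Longrightarrow> n \<ge> M \<Longrightarrow> norm (X m - X n) < e"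
      by blast
    then have M': "norm (X m - X n) \<le> e" if "m \<ge> M" "n \<ge> M" for m n
      using that by (simp add: less_imp_le)
    have "(\<Sum>x\<in>F. norm (ell1_apply (X m) x - f x)) \<le> e" if "m \<ge> M" "finite F" for m F
      by (rule fin[of M m e F, OF M'[OF that(1)] that(2)])
    then show ?thesis by blast
  qed
  obtain m where m: "\<And>F. finite F \<Longrightarrow> (\<Sum>x\<in>F. norm (ell1_apply (X m) x - f x)) \<le> 1"
    using *[of 1] by auto
  have "(\<lambda>x. norm (ell1_apply (X m) x - f x)) summable_on UNIV"
    using m by (intro nonneg_bdd_above_summable_on) (auto intro!: bdd_aboveI[of _ 1])
  from abs_summable_diff[OF ell1_summable_norm[of "X m"] this]
  have f_sum: "(\<lambda>x. norm (f x)) summable_on UNIV"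
    by simp
  have "X \<longlonglongrightarrow> Ell1 f"
  proof (rule metric_LIMSEQ_I)
    fix e :: real
    assume e: "e > 0"
    obtain M where M: "\<And>m F. m \<ge> M \<Longrightarrow> finite F \<Longrightarrow> (\<Sum>x\<in>F. norm (ell1_apply (X m) x - f x)) \<le> e / 2"
      using *[of "e / 2"] e by auto
    have "norm (X m - Ell1 f) \<le> e / 2" if "m \<ge> M" for m
      by (rule norm_ell1_bound) (use M[OF that] in \<open>simp add: ell1_apply_Ell1[OF f_sum]\<close>)
    with e show "\<exists>M. \<forall>m\<ge>M. dist (X m) (Ell1 f) < e"
      by (intro exI[of _ M]) (fastforce simp: dist_norm)
  qed
  then show "convergent X"
    by (auto simp: convergent_def)
qed

lift_definition ell1_delta :: "'a \<Rightarrow> 'a ell1" is "\<lambda>x y. if y = x then 1 else 0"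
  by (rule finite_nonzero_values_imp_summable_on) simp

lemma ell1_apply_delta: "ell1_apply (ell1_delta x) y = (if y = x then 1 else 0)"
  by (simp add: ell1_delta.rep_eq)

lemma norm_ell1_delta [simp]: "norm (ell1_delta x) = 1"
proof -
  have "norm (ell1_delta x) = (\<Sum>\<^sub>\<infinity>y\<in>{x}. norm (if y = x then 1 else 0 :: complex))"
    unfolding norm_ell1.rep_eq ell1_delta.rep_eq by (rule infsum_cong_neutral) auto
  then show ?thesis by simp
qed

lemma bounded_clinear_ell1_apply: "bounded_clinear (\<lambda>u. ell1_apply u x)"
  by (rule bounded_clinearI[where K = 1]) (auto simp: scaleC_complex_def norm_ell1_apply)

lemma ell1_has_sum_delta: "((\<lambda>x. ell1_apply u x *\<^sub>C ell1_delta x) has_sum u) UNIV"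
proof -
  have "(\<lambda>x. norm (ell1_apply u x *\<^sub>C ell1_delta x)) summable_on UNIV"
    by (simp add: ell1_summable_norm)
  then have s: "(\<lambda>x. ell1_apply u x *\<^sub>C ell1_delta x) summable_on UNIV"
    by (rule abs_summable_summable)
  define v where "v = (\<Sum>\<^sub>\<infinity>x. ell1_apply u x *\<^sub>C ell1_delta x)"
  have v: "((\<lambda>x. ell1_apply u x *\<^sub>C ell1_delta x) has_sum v) UNIV"
    using s by (simp add: v_def)
  have "ell1_apply v y = ell1_apply u y" for y
  proof -
    have "((\<lambda>x. ell1_apply (ell1_apply u x *\<^sub>C ell1_delta x) y) has_sum ell1_apply v y) UNIV"
      by (rule has_sum_bounded_linear[OF bounded_clinear_bounded_linear[OF bounded_clinear_ell1_apply] v])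
    moreover have "((\<lambda>x. ell1_apply (ell1_apply u x *\<^sub>C ell1_delta x) y) has_sum ell1_apply u y) UNIV"
      by (rule has_sum_finite_neutralI[of "{y}"]) (auto simp: ell1_apply_delta scaleC_complex_def)
    ultimately show ?thesis
      by (rule has_sum_unique)
  qed
  then have "v = u" by (rule ell1_eqI)
  with v show ?thesis by simp
qed

lemma ell1_clinear_eqI:
  fixes S T :: "'a ell1 \<Rightarrow> 'b::complex_normed_vector"
  assumes S: "bounded_clinear S" and T: "bounded_clinear T"
    and eq: "\<And>x. S (ell1_delta x) = T (ell1_delta x)"
  shows "S u = T u"
proof -
  have *: "((\<lambda>x. ell1_apply u x *\<^sub>C S (ell1_delta x)) has_sum S u) UNIV"
    if "bounded_clinear S" for S :: "'a ell1 \<Rightarrow> 'b"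
    using has_sum_bounded_linear[OF bounded_clinear_bounded_linear[OF that] ell1_has_sum_delta[of u]] that
    by (simp add: bounded_clinear_def)
  from *[OF S] *[OF T] show ?thesis
    by (auto simp: eq intro: has_sum_unique)
qed

lemma ell1_extend:
  fixes g :: "'a \<Rightarrow> 'b::complex_banach"
  assumes "\<And>x. norm (g x) \<le> K"
  obtains T where "bounded_clinear T" "\<And>x. T (ell1_delta x) = g x" "\<And>u. norm (T u) \<le> K * norm u"
proof -
  define T where "T u = (\<Sum>\<^sub>\<infinity>x. ell1_apply u x *\<^sub>C g x)" for u
  have K: "(\<lambda>x. norm (ell1_apply u x) * K) summable_on UNIV" for u
    by (intro summable_on_cmult_left ell1_summable_norm)
  have abs: "(\<lambda>x. norm (ell1_apply u x *\<^sub>C g x)) summable_on UNIV" for u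
    by (rule summable_on_comparison_test[OF K]) (auto intro: mult_left_mono assms)
  have s: "(\<lambda>x. ell1_apply u x *\<^sub>C g x) summable_on UNIV" for u
    by (rule abs_summable_summable[OF abs])
  have bound: "norm (T u) \<le> K * norm u" for u
  proof -
    have "norm (T u) \<le> (\<Sum>\<^sub>\<infinity>x. norm (ell1_apply u x *\<^sub>C g x))"
      unfolding T_def by (rule norm_infsum_bound[OF abs])
    also have "\<dots> \<le> (\<Sum>\<^sub>\<infinity>x. norm (ell1_apply u x) * K)"
      by (intro infsum_mono abs K) (auto intro: mult_left_mono assms)
    also have "\<dots> = K * norm u"
      unfolding norm_ell1.rep_eq infsum_cmult_left' by (rule mult.commute)
    finally show ?thesis .
  qed
  have "bounded_clinear T"
  proof (rule bounded_clinearI[OF _ _ bound])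
    show "T (u + v) = T u + T v" for u v
      using infsum_add[OF s[of u] s[of v]] by (simp add: T_def scaleC_add_left)
    show "T (c *\<^sub>C u) = c *\<^sub>C T u" for c u
      using infsumI[OF has_sum_bounded_linear[OF bounded_linear_scaleC_right[of c] has_sum_infsum[OF s[of u]]]]
      by (simp add: T_def)
  qed
  moreover have "T (ell1_delta x) = g x" for x
  proof -
    have "T (ell1_delta x) = (\<Sum>\<^sub>\<infinity>y\<in>{x}. ell1_apply (ell1_delta x) y *\<^sub>C g y)"
      unfolding T_def by (rule infsum_cong_neutral) (auto simp: ell1_apply_delta)
    then show ?thesis by (simp add: ell1_apply_delta)
  qed
  ultimately show thesis using bound that by blast
qed

subsection \<open>Convolution\<close>

lemma abs_summable_times:
  fixes u v :: "_ ell1"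
  shows "(\<lambda>p. norm (ell1_apply u (fst p) * ell1_apply v (snd p))) summable_on A"
    and "(\<Sum>\<^sub>\<infinity>p. norm (ell1_apply u (fst p) * ell1_apply v (snd p))) = norm u * norm v"
proof -
  have "(\<lambda>(s, t). norm (ell1_apply u s) * norm (ell1_apply v t)) summable_on (UNIV \<times> UNIV)"
    by (rule summable_on_SigmaI[where g = "\<lambda>s. norm (ell1_apply u s) * norm v"])
      (auto simp: norm_ell1.rep_eq
        intro!: has_sum_cmult_right has_sum_infsum summable_on_cmult_left ell1_summable_norm)
  then have s: "(\<lambda>p. norm (ell1_apply u (fst p) * ell1_apply v (snd p))) summable_on (UNIV \<times> UNIV)"
    by (simp add: norm_mult case_prod_unfold)
  then show "(\<lambda>p. norm (ell1_apply u (fst p) * ell1_apply v (snd p))) summable_on A"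
    by (rule summable_on_subset_banach) auto
  have "(\<Sum>\<^sub>\<infinity>p\<in>UNIV \<times> UNIV. norm (ell1_apply u (fst p) * ell1_apply v (snd p)))
      = (\<Sum>\<^sub>\<infinity>s. \<Sum>\<^sub>\<infinity>t. norm (ell1_apply u s * ell1_apply v t))"
    using infsum_Sigma'_banach[of "\<lambda>s t. norm (ell1_apply u s * ell1_apply v t)" UNIV "\<lambda>_. UNIV"] s
    by (simp add: case_prod_unfold)
  also have "\<dots> = norm u * norm v"
    by (simp add: norm_mult norm_ell1.rep_eq infsum_cmult_left' infsum_cmult_right')
  finally show "(\<Sum>\<^sub>\<infinity>p. norm (ell1_apply u (fst p) * ell1_apply v (snd p))) = norm u * norm v"
    by simp
qed

lemma
  fixes u v :: "'s::semigroup_mult ell1"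
  defines "conv \<equiv> (\<lambda>x. \<Sum>\<^sub>\<infinity>(s, t)\<in>{(s, t). s * t = x}. ell1_apply u s * ell1_apply v t)"
  shows conv_summable: "(\<lambda>x. norm (conv x)) summable_on UNIV"
    and conv_bound: "(\<Sum>\<^sub>\<infinity>x. norm (conv x)) \<le> norm u * norm v"
proof -
  let ?F = "\<lambda>p. norm (ell1_apply u (fst p) * ell1_apply v (snd p))"
  let ?fib = "\<lambda>x::'s. {(s, t). s * t = x}"
  have bij: "bij_betw (\<lambda>p. (fst p * snd p, p)) UNIV (Sigma UNIV ?fib)"
    by (rule bij_betwI[where g = snd]) auto
  have s: "(\<lambda>(x, p). ?F p) summable_on (Sigma UNIV ?fib)"
    using summable_on_reindex_bij_betw[OF bij, of "\<lambda>(x, p). ?F p"] abs_summable_times(1)[of u v UNIV]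
    by (simp add: case_prod_unfold)
  have eq: "(\<Sum>\<^sub>\<infinity>x. \<Sum>\<^sub>\<infinity>p\<in>?fib x. ?F p) = norm u * norm v"
    using infsum_Sigma'_banach[OF s] infsum_reindex_bij_betw[OF bij, of "\<lambda>(x, p). ?F p"]
    by (simp add: case_prod_unfold abs_summable_times(2))
  have s': "(\<lambda>x. \<Sum>\<^sub>\<infinity>p\<in>?fib x. ?F p) summable_on UNIV"
    using summable_on_Sigma_banach[OF s] by simp
  have le: "norm (conv x) \<le> (\<Sum>\<^sub>\<infinity>p\<in>?fib x. ?F p)" for x
    unfolding conv_def case_prod_unfold by (rule norm_infsum_bound[OF abs_summable_times(1)])
  show c: "(\<lambda>x. norm (conv x)) summable_on UNIV"
    by (rule summable_on_comparison_test[OF s']) (auto simp: le)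
  show "(\<Sum>\<^sub>\<infinity>x. norm (conv x)) \<le> norm u * norm v"
    using infsum_mono[OF c s' le] eq by simp
qed

lift_definition ell1_conv :: "'s::semigroup_mult ell1 \<Rightarrow> 's ell1 \<Rightarrow> 's ell1" is
  "\<lambda>f g x. \<Sum>\<^sub>\<infinity>(s, t)\<in>{(s, t). s * t = x}. f s * g t"
  subgoal for f g using conv_summable[of "Ell1 f" "Ell1 g"] by (simp add: Ell1_inverse)
  done

lemma ell1_conv_bound: "norm (ell1_conv u v) \<le> norm u * norm v"
  using conv_bound[of u v] by (simp add: norm_ell1.rep_eq ell1_conv.rep_eq)

lemma bounded_clinear_ell1_conv_left: "bounded_clinear (\<lambda>u. ell1_conv u v)"
proof (rule bounded_clinearI[where K = "norm v"])
  have s: "(\<lambda>p. ell1_apply u (fst p) * ell1_apply v (snd p)) summable_on A" for u v :: "'a ell1" and A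
    by (rule abs_summable_summable[OF abs_summable_times(1)])
  show "ell1_conv (u + w) v = ell1_conv u v + ell1_conv w v" for u w
    by (rule ell1_eqI) (simp add: ell1_conv.rep_eq case_prod_unfold distrib_right infsum_add[OF s s])
  show "ell1_conv (c *\<^sub>C u) v = c *\<^sub>C ell1_conv u v" for c u
    by (rule ell1_eqI)
      (simp add: ell1_conv.rep_eq case_prod_unfold mult.assoc infsum_cmult_right')
  show "norm (ell1_conv u v) \<le> norm v * norm u" for u
    using ell1_conv_bound[of u v] by (simp add: mult.commute)
qed

lemma bounded_clinear_ell1_conv_right: "bounded_clinear (\<lambda>v. ell1_conv u v)"
proof (rule bounded_clinearI[where K = "norm u"])
  have s: "(\<lambda>p. ell1_apply u (fst p) * ell1_apply v (snd p)) summable_on A" for u v :: "'a ell1" and A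
    by (rule abs_summable_summable[OF abs_summable_times(1)])
  show "ell1_conv u (v + w) = ell1_conv u v + ell1_conv u w" for v w
    by (rule ell1_eqI) (simp add: ell1_conv.rep_eq case_prod_unfold distrib_left infsum_add[OF s s])
  show "ell1_conv u (c *\<^sub>C v) = c *\<^sub>C ell1_conv u v" for c v
    by (rule ell1_eqI)
      (simp add: ell1_conv.rep_eq case_prod_unfold mult.left_commute infsum_cmult_right')
  show "norm (ell1_conv u v) \<le> norm u * norm v" for v
    by (rule ell1_conv_bound)
qed

lemma ell1_conv_delta: "ell1_conv (ell1_delta s) (ell1_delta t) = ell1_delta (s * t)"
proof (rule ell1_eqI)
  fix x
  let ?A = "if s * t = x then {(s, t)} else {}"
  have "ell1_apply (ell1_conv (ell1_delta s) (ell1_delta t)) x =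
      (\<Sum>\<^sub>\<infinity>(a, b)\<in>?A. ell1_apply (ell1_delta s) a * ell1_apply (ell1_delta t) b)"
    unfolding ell1_conv.rep_eq by (rule infsum_cong_neutral) (auto simp: ell1_apply_delta split: if_splits)
  then show "ell1_apply (ell1_conv (ell1_delta s) (ell1_delta t)) x = ell1_apply (ell1_delta (s * t)) x"
    by (auto simp: ell1_apply_delta)
qed

lemma ell1_conv_assoc: "ell1_conv (ell1_conv u v) w = ell1_conv u (ell1_conv v w)"
proof -
  note L = bounded_clinear_ell1_conv_left and R = bounded_clinear_ell1_conv_right
  have 1: "ell1_conv (ell1_conv (ell1_delta r) (ell1_delta s)) w = ell1_conv (ell1_delta r) (ell1_conv (ell1_delta s) w)"
    for r s
    by (rule ell1_clinear_eqI[of "\<lambda>w. ell1_conv (ell1_conv (ell1_delta r) (ell1_delta s)) w"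
          "\<lambda>w. ell1_conv (ell1_delta r) (ell1_conv (ell1_delta s) w)"])
      (intro R bounded_clinear_compose[OF R R], intro R bounded_clinear_compose[OF R R],
        simp add: ell1_conv_delta mult.assoc)
  have 2: "ell1_conv (ell1_conv (ell1_delta r) v) w = ell1_conv (ell1_delta r) (ell1_conv v w)" for r
    by (rule ell1_clinear_eqI[of "\<lambda>v. ell1_conv (ell1_conv (ell1_delta r) v) w"
          "\<lambda>v. ell1_conv (ell1_delta r) (ell1_conv v w)"])
      (rule bounded_clinear_compose[OF L R] bounded_clinear_compose[OF R L] 1)+
  show ?thesis
    by (rule ell1_clinear_eqI[of "\<lambda>u. ell1_conv (ell1_conv u v) w" "\<lambda>u. ell1_conv u (ell1_conv v w)"])
      (rule bounded_clinear_compose[OF L L] L 2)+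
qed

instantiation ell1 :: (semigroup_mult) complex_banach_algebra
begin

definition times_ell1 :: "'a ell1 \<Rightarrow> 'a ell1 \<Rightarrow> 'a ell1" where
  "times_ell1 = ell1_conv"

instance
proof
  note L = bounded_clinear_ell1_conv_left and R = bounded_clinear_ell1_conv_right
  fix u v w :: "'a ell1" and r :: real and c :: complex
  show "u * v * w = u * (v * w)"
    by (simp add: times_ell1_def ell1_conv_assoc)
  show "(u + v) * w = u * w + v * w"
    using linear_add[OF bounded_linear.linear[OF bounded_clinear_bounded_linear[OF L]]]
    by (simp add: times_ell1_def)
  show "u * (v + w) = u * v + u * w"
    using linear_add[OF bounded_linear.linear[OF bounded_clinear_bounded_linear[OF R]]]
    by (simp add: times_ell1_def)
  have C1: "(c *\<^sub>C u) * v = c *\<^sub>C (u * v)" and C2: "u * (c *\<^sub>C v) = c *\<^sub>C (u * v)"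
    for c and u v :: "'a ell1"
    using L[of v] R[of u] by (auto simp: times_ell1_def bounded_clinear_def)
  show "(c *\<^sub>C u) * v = c *\<^sub>C (u * v)" "u * (c *\<^sub>C v) = c *\<^sub>C (u * v)"
    by (fact C1, fact C2)
  show "(r *\<^sub>R u) * v = r *\<^sub>R (u * v)" "u * (r *\<^sub>R v) = r *\<^sub>R (u * v)"
    using C1[of "of_real r" u v] C2[of u "of_real r" v] by (simp_all add: scaleC_of_real)
  show "norm (u * v) \<le> norm u * norm v"
    by (simp add: times_ell1_def ell1_conv_bound)
qed

end

lemma ell1_delta_mult: "ell1_delta s * ell1_delta t = ell1_delta (s * t)"
  by (simp add: times_ell1_def ell1_conv_delta)

section \<open>The projective tensor product\<close>

text \<open>
  The projective tensor product of \<open>A\<close> and \<open>B\<close> is realised as a quotient of \<open>\<ell>\<^sup>1(A \<times> B)\<close>.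
  The basis vector at \<open>(a, b)\<close> stands for \<open>sgn a \<otimes> sgn b\<close>, where \<open>sgn a = a / \<parallel>a\<parallel>\<close> and
  \<open>sgn 0 = 0\<close>; hence \<open>a \<otimes> b\<close> is represented by \<open>\<parallel>a\<parallel> \<parallel>b\<parallel>\<close> times that basis vector, and the basis
  vectors with \<open>a = 0\<close> or \<open>b = 0\<close> must be killed together with the bilinearity relations.
  On finitely supported functions the quotient seminorm is the infimum of \<open>\<Sum> \<parallel>a\<^sub>i\<parallel> \<parallel>b\<^sub>i\<parallel>\<close> over all
  representations, i.e. the projective norm of the algebraic tensor product; passing to
  \<open>\<ell>\<^sup>1\<close> and to the closure of the relations is its completion.  The facts
  \<open>norm_tensor_le\<close>, \<open>cblinfun_ptensor_eqI\<close> and \<open>ptensor_universal\<close> below are the universal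
  property, with norm bounds, that determines it up to isometric isomorphism.
\<close>

definition pre_tensor ::
  "'a::complex_normed_vector \<Rightarrow> 'b::complex_normed_vector \<Rightarrow> ('a \<times> 'b) ell1" where
  "pre_tensor a b = complex_of_real (norm a * norm b) *\<^sub>C ell1_delta (a, b)"

inductive_set tensor_relations :: "('a::complex_normed_vector \<times> 'b::complex_normed_vector) ell1 set" where
  zero: "0 \<in> tensor_relations"
| add: "u \<in> tensor_relations \<Longrightarrow> v \<in> tensor_relations \<Longrightarrow> u + v \<in> tensor_relations"
| scale: "u \<in> tensor_relations \<Longrightarrow> c *\<^sub>C u \<in> tensor_relations"
| degenerate: "a = 0 \<or> b = 0 \<Longrightarrow> ell1_delta (a, b) \<in> tensor_relations"
| add_left: "pre_tensor (a + a') b - (pre_tensor a b + pre_tensor a' b) \<in> tensor_relations"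
| add_right: "pre_tensor a (b + b') - (pre_tensor a b + pre_tensor a b') \<in> tensor_relations"
| scale_left: "pre_tensor (c *\<^sub>C a) b - c *\<^sub>C pre_tensor a b \<in> tensor_relations"
| scale_right: "pre_tensor a (c *\<^sub>C b) - c *\<^sub>C pre_tensor a b \<in> tensor_relations"

definition tensor_null :: "('a::complex_normed_vector \<times> 'b::complex_normed_vector) ell1 set" where
  "tensor_null = closure tensor_relations"

lemma tensor_null_relations: "u \<in> tensor_relations \<Longrightarrow> u \<in> tensor_null"
  unfolding tensor_null_def using closure_subset by blast

lemma tensor_null_zero [simp]: "0 \<in> tensor_null"
  by (intro tensor_null_relations tensor_relations.zero)

lemma tensor_null_add:
  assumes "u \<in> tensor_null" "v \<in> tensor_null"
  shows "u + v \<in> tensor_null"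
proof -
  obtain f where f: "\<And>n. f n \<in> tensor_relations" "f \<longlonglongrightarrow> u"
    using assms(1) unfolding tensor_null_def closure_sequential by blast
  obtain g where g: "\<And>n. g n \<in> tensor_relations" "g \<longlonglongrightarrow> v"
    using assms(2) unfolding tensor_null_def closure_sequential by blast
  show ?thesis
    unfolding tensor_null_def closure_sequential
    by (rule exI[of _ "\<lambda>n. f n + g n"]) (auto intro!: tendsto_add tensor_relations.add f g)
qed

lemma tensor_null_scaleC:
  assumes "u \<in> tensor_null"
  shows "c *\<^sub>C u \<in> tensor_null"
proof -
  obtain f where f: "\<And>n. f n \<in> tensor_relations" "f \<longlonglongrightarrow> u"
    using assms(1) unfolding tensor_null_def closure_sequential by blast
  show ?thesis
    unfolding tensor_null_def closure_sequential
    by (rule exI[of _ "\<lambda>n. c *\<^sub>C f n"])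
      (auto intro!: bounded_linear.tendsto[OF bounded_linear_scaleC_right] tensor_relations.scale f)
qed

lemma tensor_null_scaleR: "u \<in> tensor_null \<Longrightarrow> r *\<^sub>R u \<in> tensor_null"
  using tensor_null_scaleC[of u "of_real r"] by (simp add: scaleC_of_real)

lemma tensor_null_uminus: "u \<in> tensor_null \<Longrightarrow> - u \<in> tensor_null"
  using tensor_null_scaleR[of u "-1"] by simp

lemma tensor_null_diff: "u \<in> tensor_null \<Longrightarrow> v \<in> tensor_null \<Longrightarrow> u - v \<in> tensor_null"
  using tensor_null_add[of u "- v"] tensor_null_uminus[of v] by simp

lemma closed_tensor_null: "closed tensor_null"
  by (simp add: tensor_null_def)

quotient_type (overloaded) ('a, 'b) ptensor =
  "('a::complex_normed_vector \<times> 'b::complex_normed_vector) ell1" / "\<lambda>u v. u - v \<in> tensor_null"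
  morphisms rep_ptensor ptensor_class
proof (rule equivpI)
  show "reflp (\<lambda>u v::('a \<times> 'b) ell1. u - v \<in> tensor_null)"
    by (simp add: reflp_def)
  show "symp (\<lambda>u v::('a \<times> 'b) ell1. u - v \<in> tensor_null)"
    using tensor_null_uminus by (force intro: sympI)
  show "transp (\<lambda>u v::('a \<times> 'b) ell1. u - v \<in> tensor_null)"
    using tensor_null_add by (force intro: transpI)
qed

lemma ptensor_class_eq_iff: "ptensor_class u = ptensor_class v \<longleftrightarrow> u - v \<in> tensor_null"
  by (rule ptensor.abs_eq_iff)

lemma infdist_tensor_null_le: "n \<in> tensor_null \<Longrightarrow> infdist u tensor_null \<le> norm (u - n)"
  using infdist_le[of n tensor_null u] by (simp add: dist_norm)

lemma infdist_tensor_null_approx: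
  assumes "e > 0"
  obtains n where "n \<in> tensor_null" "norm (u - n) < infdist u tensor_null + e"
proof -
  have "(INF n\<in>tensor_null. dist u n) < infdist u tensor_null + e"
    using assms infdist_notempty[of tensor_null u] tensor_null_zero by fastforce
  then obtain n where "n \<in> tensor_null" "dist u n < infdist u tensor_null + e"
    by (subst (asm) cINF_less_iff) (auto intro: tensor_null_zero)
  then show thesis
    using that by (simp add: dist_norm)
qed

lemma infdist_tensor_null_cong_le:
  assumes "u - v \<in> tensor_null"
  shows "infdist u tensor_null \<le> infdist v tensor_null"
proof (rule field_le_epsilon)
  fix e :: real assume "e > 0"
  then obtain n where n: "n \<in> tensor_null" "norm (v - n) < infdist v tensor_null + e"
    by (rule infdist_tensor_null_approx)
  have "infdist u tensor_null \<le> norm (u - ((u - v) + n))"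
    by (intro infdist_tensor_null_le tensor_null_add assms n)
  with n show "infdist u tensor_null \<le> infdist v tensor_null + e" by simp
qed

lemma infdist_tensor_null_cong:
  assumes "u - v \<in> tensor_null"
  shows "infdist u tensor_null = infdist v tensor_null"
  using infdist_tensor_null_cong_le[OF assms] infdist_tensor_null_cong_le[of v u]
    tensor_null_uminus[OF assms] by simp

lemma infdist_tensor_null_triangle:
  "infdist (u + v) tensor_null \<le> infdist u tensor_null + infdist v tensor_null"
proof (rule field_le_epsilon)
  fix e :: real assume "e > 0"
  then have e: "e / 2 > 0" by simp
  obtain m where m: "m \<in> tensor_null" "norm (u - m) < infdist u tensor_null + e / 2"
    using e by (rule infdist_tensor_null_approx)
  obtain n where n: "n \<in> tensor_null" "norm (v - n) < infdist v tensor_null + e / 2"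
    using e by (rule infdist_tensor_null_approx)
  have "infdist (u + v) tensor_null \<le> norm ((u + v) - (m + n))"
    by (intro infdist_tensor_null_le tensor_null_add m n)
  also have "\<dots> \<le> norm (u - m) + norm (v - n)"
    using norm_triangle_ineq[of "u - m" "v - n"] by (simp add: algebra_simps)
  finally show "infdist (u + v) tensor_null \<le> infdist u tensor_null + infdist v tensor_null + e"
    using m n by linarith
qed

lemma infdist_tensor_null_scaleC:
  "infdist (c *\<^sub>C u) tensor_null = norm c * infdist u tensor_null"
proof -
  have le: "infdist (c *\<^sub>C u) tensor_null \<le> norm c * infdist u tensor_null"
    if "c \<noteq> 0" for c and u :: "('a \<times> 'b) ell1"
  proof (rule field_le_epsilon)
    fix e :: real assume "e > 0"
    then have e: "e / norm c > 0" using that by simp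
    obtain n where n: "n \<in> tensor_null" "norm (u - n) < infdist u tensor_null + e / norm c"
      using e by (rule infdist_tensor_null_approx)
    have "infdist (c *\<^sub>C u) tensor_null \<le> norm (c *\<^sub>C u - c *\<^sub>C n)"
      by (intro infdist_tensor_null_le tensor_null_scaleC n)
    also have "\<dots> = norm c * norm (u - n)"
      by (simp flip: scaleC_diff_right)
    also have "\<dots> \<le> norm c * (infdist u tensor_null + e / norm c)"
      using n by (intro mult_left_mono) auto
    finally show "infdist (c *\<^sub>C u) tensor_null \<le> norm c * infdist u tensor_null + e"
      using that by (simp add: distrib_left)
  qed
  show ?thesis
  proof (cases "c = 0")
    case True
    then show ?thesis by (simp add: infdist_zero)
  next
    case False
    have "infdist u tensor_null \<le> norm (inverse c) * infdist (c *\<^sub>C u) tensor_null"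
      using le[of "inverse c" "c *\<^sub>C u"] False by simp
    then have "norm c * infdist u tensor_null
        \<le> norm c * (norm (inverse c) * infdist (c *\<^sub>C u) tensor_null)"
      by (rule mult_left_mono) simp
    also have "\<dots> = infdist (c *\<^sub>C u) tensor_null"
      using False by (simp add: norm_inverse)
    finally have "norm c * infdist u tensor_null \<le> infdist (c *\<^sub>C u) tensor_null" .
    with le[OF False, of u] show ?thesis by simp
  qed
qed

instantiation ptensor :: (complex_normed_vector, complex_normed_vector) complex_normed_vector
begin

lift_definition norm_ptensor :: "('a, 'b) ptensor \<Rightarrow> real" is "\<lambda>u. infdist u tensor_null"
  by (rule infdist_tensor_null_cong)
lift_definition zero_ptensor :: "('a, 'b) ptensor" is 0 .
lift_definition plus_ptensor :: "('a, 'b) ptensor \<Rightarrow> ('a, 'b) ptensor \<Rightarrow> ('a, 'b) ptensor" is plus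
  by (drule (1) tensor_null_add) (simp add: algebra_simps)
lift_definition minus_ptensor :: "('a, 'b) ptensor \<Rightarrow> ('a, 'b) ptensor \<Rightarrow> ('a, 'b) ptensor" is minus
  by (drule (1) tensor_null_diff) (simp add: algebra_simps)
lift_definition uminus_ptensor :: "('a, 'b) ptensor \<Rightarrow> ('a, 'b) ptensor" is uminus
  by (drule tensor_null_uminus) (simp add: algebra_simps)
lift_definition scaleR_ptensor :: "real \<Rightarrow> ('a, 'b) ptensor \<Rightarrow> ('a, 'b) ptensor" is scaleR
  by (metis scaleR_diff_right tensor_null_scaleR)
lift_definition scaleC_ptensor :: "complex \<Rightarrow> ('a, 'b) ptensor \<Rightarrow> ('a, 'b) ptensor" is scaleC
  by (metis scaleC_diff_right tensor_null_scaleC)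

definition dist_ptensor :: "('a, 'b) ptensor \<Rightarrow> ('a, 'b) ptensor \<Rightarrow> real" where
  "dist_ptensor u v = norm (u - v)"
definition sgn_ptensor :: "('a, 'b) ptensor \<Rightarrow> ('a, 'b) ptensor" where
  "sgn_ptensor u = inverse (norm u) *\<^sub>R u"
definition [code del]:
  "(uniformity :: (('a, 'b) ptensor \<times> ('a, 'b) ptensor) filter) =
     (INF e\<in>{0 <..}. principal {(x, y). dist x y < e})"
definition open_ptensor :: "('a, 'b) ptensor set \<Rightarrow> bool" where
  [code del]: "open_ptensor S = (\<forall>x\<in>S. \<forall>\<^sub>F (x', y) in uniformity. x' = x \<longrightarrow> y \<in> S)"

instance
proof
  fix u v :: "('a, 'b) ptensor" and r :: real and c :: complex
  show "norm (u + v) \<le> norm u + norm v"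
    by transfer (rule infdist_tensor_null_triangle)
  show "norm (c *\<^sub>C u) = norm c * norm u"
    by transfer (rule infdist_tensor_null_scaleC)
  show "norm (r *\<^sub>R u) = \<bar>r\<bar> * norm u"
  proof transfer
    show "infdist (r *\<^sub>R u) tensor_null = \<bar>r\<bar> * infdist u tensor_null" for r and u :: "('a \<times> 'b) ell1"
      using infdist_tensor_null_scaleC[of "of_real r" u] by (simp add: scaleC_of_real)
  qed
  show "norm u = 0 \<longleftrightarrow> u = 0"
  proof transfer
    have "(tensor_null :: ('a \<times> 'b) ell1 set) \<noteq> {}"
      using tensor_null_zero by blast
    then show "infdist u tensor_null = 0 \<longleftrightarrow> u - 0 \<in> tensor_null" for u :: "('a \<times> 'b) ell1"
      using in_closed_iff_infdist_zero[OF closed_tensor_null, of u] by simp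
  qed
qed ((simp only: dist_ptensor_def sgn_ptensor_def uniformity_ptensor_def open_ptensor_def)
   | (transfer, simp add: scaleR_add_left scaleR_add_right scaleC_add_left scaleC_add_right
        scaleC_of_real add.assoc))+

end

lemma bounded_clinear_ptensor_class: "bounded_clinear ptensor_class"
proof (rule bounded_clinearI[where K = 1])
  show "norm (ptensor_class u) \<le> 1 * norm u" for u :: "('a \<times> 'b) ell1"
    using infdist_tensor_null_le[of 0 u] by (simp add: norm_ptensor.abs_eq)
qed (simp_all add: plus_ptensor.abs_eq scaleC_ptensor.abs_eq)

lemma ptensor_cases: obtains u where "p = ptensor_class u"
  using Quotient3_abs_rep[OF Quotient3_ptensor, of p] by metis

instance ptensor :: (complex_normed_vector, complex_normed_vector) complex_banach
proof
  fix X :: "nat \<Rightarrow> ('a, 'b) ptensor"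
  assume X: "Cauchy X"
  have "\<exists>M. \<forall>m\<ge>M. \<forall>n\<ge>M. norm (X m - X n) < (1/2) ^ k" for k :: nat
    using CauchyD[OF X, of "(1/2) ^ k"] by simp
  then obtain M where M: "\<And>k m n. m \<ge> M k \<Longrightarrow> n \<ge> M k \<Longrightarrow> norm (X m - X n) < (1/2) ^ k"
    by metis
  define r where "r n = Max (M ` {..n})" for n
  have r: "M k \<le> r n" if "k \<le> n" for k n
    unfolding r_def using that by (intro Max_ge) auto
  have ex: "\<exists>v. ptensor_class v = p \<and> norm (v - u) < e"
    if "norm (p - ptensor_class u) < e" for p :: "('a, 'b) ptensor" and u e
  proof -
    obtain w where w: "p = ptensor_class w" by (rule ptensor_cases)
    have lt: "infdist (w - u) tensor_null < e"
      using that by (simp add: w minus_ptensor.abs_eq norm_ptensor.abs_eq)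
    then obtain n where n: "n \<in> tensor_null" "norm (w - u - n) < infdist (w - u) tensor_null + (e - infdist (w - u) tensor_null)"
      by (metis diff_gt_0_iff_gt infdist_tensor_null_approx)
    have "ptensor_class (w - n) = p"
      using n tensor_null_uminus by (auto simp: w ptensor_class_eq_iff)
    moreover have "norm ((w - n) - u) < e"
      using n by (simp add: algebra_simps)
    ultimately show ?thesis by blast
  qed
  obtain u where u: "\<And>n. ptensor_class (u n) = X (r n) \<and> norm (u (Suc n) - u n) < (1/2) ^ n"
  proof -
    have "\<exists>u. \<forall>n. ptensor_class (u n) = X (r n) \<and> norm (u (Suc n) - u n) < (1/2) ^ n"
    proof (rule dependent_nat_choice)
      show "\<exists>v. ptensor_class v = X (r 0)"
        by (metis ptensor_cases)
      fix v n assume v: "ptensor_class v = X (r n)"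
      have "norm (X (r (Suc n)) - ptensor_class v) < (1/2) ^ n"
        unfolding v by (rule M) (auto intro: r)
      from ex[OF this] show "\<exists>w. ptensor_class w = X (r (Suc n)) \<and> norm (w - v) < (1/2) ^ n" .
    qed
    then show thesis using that by blast
  qed
  have "summable (\<lambda>n. u (Suc n) - u n)"
    by (rule summable_norm_cancel, rule summable_comparison_test[of _ "\<lambda>n. (1/2) ^ n"])
      (use u in \<open>auto intro!: exI[of _ 0] less_imp_le simp: summable_geometric\<close>)
  then have "convergent (\<lambda>n. \<Sum>i<n. u (Suc i) - u i)"
    by (simp add: summable_iff_convergent)
  then have "convergent (\<lambda>n. u n - u 0)"
    by (simp add: sum_lessThan_telescope)
  then have "convergent u"
    using convergent_add_const_right_iff[of u "- u 0"] by simp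
  then obtain l where l: "u \<longlonglongrightarrow> l"
    by (auto simp: convergent_def)
  have Xr: "(\<lambda>n. X (r n)) \<longlonglongrightarrow> ptensor_class l"
    using bounded_linear.tendsto[OF bounded_clinear_bounded_linear[OF bounded_clinear_ptensor_class] l] u
    by simp
  have "X \<longlonglongrightarrow> ptensor_class l"
  proof (rule metric_LIMSEQ_I)
    fix e :: real assume e: "e > 0"
    then obtain k where k: "(1/2) ^ k < e / 2"
      using real_arch_pow_inv[of "e / 2" "1/2"] by auto
    obtain n0 where n0: "\<And>n. n \<ge> n0 \<Longrightarrow> dist (X (r n)) (ptensor_class l) < e / 2"
      using metric_LIMSEQ_D[OF Xr, of "e / 2"] e by auto
    have "dist (X m) (ptensor_class l) < e" if "m \<ge> M k" for m
    proof -
      have "dist (X m) (X (r (max k n0))) < e / 2"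
        using M[OF that r[of k "max k n0"]] k by (simp add: dist_norm)
      moreover have "dist (X (r (max k n0))) (ptensor_class l) < e / 2"
        by (rule n0) simp
      ultimately show ?thesis
        using dist_triangle[of "X m" "ptensor_class l" "X (r (max k n0))"] by linarith
    qed
    then show "\<exists>N. \<forall>m\<ge>N. dist (X m) (ptensor_class l) < e" by blast
  qed
  then show "convergent X"
    by (auto simp: convergent_def)
qed

definition tensor ::
  "'a::complex_normed_vector \<Rightarrow> 'b::complex_normed_vector \<Rightarrow> ('a, 'b) ptensor"  (infixr \<open>\<otimes>\<^sub>p\<close> 70) where
  "a \<otimes>\<^sub>p b = ptensor_class (pre_tensor a b)"

definition bounded_cbilinear ::
  "('a::complex_normed_vector \<Rightarrow> 'b::complex_normed_vector \<Rightarrow> 'c::complex_normed_vector) \<Rightarrow> bool" where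
  "bounded_cbilinear \<Phi> \<longleftrightarrow> bounded_bilinear \<Phi> \<and>
     (\<forall>c a b. \<Phi> (c *\<^sub>C a) b = c *\<^sub>C \<Phi> a b) \<and> (\<forall>c a b. \<Phi> a (c *\<^sub>C b) = c *\<^sub>C \<Phi> a b)"

lemma bounded_cbilinearI:
  assumes "\<And>a a' b. \<Phi> (a + a') b = \<Phi> a b + \<Phi> a' b" "\<And>a b b'. \<Phi> a (b + b') = \<Phi> a b + \<Phi> a b'"
    and "\<And>c a b. \<Phi> (c *\<^sub>C a) b = c *\<^sub>C \<Phi> a b" "\<And>c a b. \<Phi> a (c *\<^sub>C b) = c *\<^sub>C \<Phi> a b"
    and "\<And>a b. norm (\<Phi> a b) \<le> K * (norm a * norm b)"
  shows "bounded_cbilinear \<Phi>"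
  unfolding bounded_cbilinear_def
proof (intro conjI allI)
  show "bounded_bilinear \<Phi>"
  proof
    show "\<Phi> (r *\<^sub>R a) b = r *\<^sub>R \<Phi> a b" "\<Phi> a (r *\<^sub>R b) = r *\<^sub>R \<Phi> a b" for r a b
      using assms(3)[of "of_real r" a b] assms(4)[of a "of_real r" b] by (simp_all add: scaleC_of_real)
    show "\<exists>K. \<forall>a b. norm (\<Phi> a b) \<le> norm a * norm b * K"
      using assms(5) by (intro exI[of _ K]) (simp add: mult.commute)
  qed (fact assms)+
qed (fact assms)+

lemma norm_tensor_le: "norm (a \<otimes>\<^sub>p b) \<le> norm a * norm b"
  using infdist_tensor_null_le[of 0 "pre_tensor a b"]
  by (simp add: tensor_def norm_ptensor.abs_eq pre_tensor_def norm_mult)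

lemma ptensor_class_minus: "ptensor_class u - ptensor_class v = ptensor_class (u - v)"
  and ptensor_class_plus: "ptensor_class u + ptensor_class v = ptensor_class (u + v)"
  and ptensor_class_scaleC: "c *\<^sub>C ptensor_class u = ptensor_class (c *\<^sub>C u)"
  by (simp_all add: minus_ptensor.abs_eq plus_ptensor.abs_eq scaleC_ptensor.abs_eq)

lemma tensor_add_left: "(a + a') \<otimes>\<^sub>p b = a \<otimes>\<^sub>p b + a' \<otimes>\<^sub>p b"
  and tensor_add_right: "a \<otimes>\<^sub>p (b + b') = a \<otimes>\<^sub>p b + a \<otimes>\<^sub>p b'"
  and tensor_scaleC_left: "(c *\<^sub>C a) \<otimes>\<^sub>p b = c *\<^sub>C (a \<otimes>\<^sub>p b)"
  and tensor_scaleC_right: "a \<otimes>\<^sub>p (c *\<^sub>C b) = c *\<^sub>C (a \<otimes>\<^sub>p b)"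
  unfolding tensor_def ptensor_class_plus ptensor_class_scaleC ptensor_class_eq_iff
  by (intro tensor_null_relations tensor_relations.intros)+

lemma bounded_cbilinear_tensor: "bounded_cbilinear tensor"
  by (rule bounded_cbilinearI[where K = 1])
    (simp_all add: tensor_add_left tensor_add_right tensor_scaleC_left tensor_scaleC_right norm_tensor_le)

lemma ptensor_class_delta:
  "ptensor_class (ell1_delta (a, b)) = complex_of_real (inverse (norm a * norm b)) *\<^sub>C (a \<otimes>\<^sub>p b)"
proof (cases "a = 0 \<or> b = 0")
  case True
  then have "ptensor_class (ell1_delta (a, b)) = ptensor_class 0"
    unfolding ptensor_class_eq_iff by (simp add: tensor_null_relations tensor_relations.degenerate)
  also have "\<dots> = 0" by (simp add: zero_ptensor.abs_eq)
  finally show ?thesis using True by auto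
next
  case False
  then have "inverse (norm a * norm b) * (norm a * norm b) = 1"
    by (intro left_inverse) simp
  then show ?thesis
    by (simp only: tensor_def pre_tensor_def ptensor_class_scaleC scaleC_scaleC of_real_1 scaleC_one
        flip: of_real_mult)
qed

lemma cblinfun_ptensor_eqI:
  fixes S T :: "('a::complex_normed_vector, 'b::complex_normed_vector) ptensor \<Rightarrow>\<^sub>C\<^sub>L 'c::complex_normed_vector"
  assumes "\<And>a b. cblinfun_apply S (a \<otimes>\<^sub>p b) = cblinfun_apply T (a \<otimes>\<^sub>p b)"
  shows "S = T"
proof (rule cblinfun_eqI)
  fix p
  obtain u :: "('a \<times> 'b) ell1" where p: "p = ptensor_class u" by (rule ptensor_cases)
  have *: "bounded_clinear (\<lambda>u::('a \<times> 'b) ell1. cblinfun_apply S (ptensor_class u))"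
    for S :: "('a, 'b) ptensor \<Rightarrow>\<^sub>C\<^sub>L 'c"
    by (rule bounded_clinear_compose[OF bounded_clinear_cblinfun_apply bounded_clinear_ptensor_class])
  have "cblinfun_apply S (ptensor_class u) = cblinfun_apply T (ptensor_class u)"
  proof (rule ell1_clinear_eqI[OF * *])
    fix x :: "'a \<times> 'b"
    show "cblinfun_apply S (ptensor_class (ell1_delta x)) = cblinfun_apply T (ptensor_class (ell1_delta x))"
      by (cases x) (simp add: ptensor_class_delta assms)
  qed
  then show "cblinfun_apply S p = cblinfun_apply T p" by (simp add: p)
qed

theorem ptensor_universal:
  fixes \<Phi> :: "'a::complex_normed_vector \<Rightarrow> 'b::complex_normed_vector \<Rightarrow> 'c::complex_banach"
  assumes \<Phi>: "bounded_cbilinear \<Phi>" and bound: "\<And>a b. norm (\<Phi> a b) \<le> K * (norm a * norm b)" and K: "0 \<le> K"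
  shows "\<exists>T :: ('a, 'b) ptensor \<Rightarrow>\<^sub>C\<^sub>L 'c. (\<forall>a b. cblinfun_apply T (a \<otimes>\<^sub>p b) = \<Phi> a b) \<and> norm T \<le> K"
proof -
  interpret bounded_bilinear \<Phi> using \<Phi> by (simp add: bounded_cbilinear_def)
  define g where "g = (\<lambda>(a, b). \<Phi> (sgn a) (sgn b))"
  have gK: "norm (g x) \<le> K" for x
  proof (cases x)
    case (Pair a b)
    have "norm (\<Phi> (sgn a) (sgn b)) \<le> K * (norm (sgn a) * norm (sgn b))" by (rule bound)
    also have "\<dots> \<le> K * 1"
      using K by (intro mult_left_mono) (auto simp: norm_sgn)
    finally show ?thesis by (simp add: g_def Pair)
  qed
  obtain T where T: "bounded_clinear T" and Tg: "\<And>x. T (ell1_delta x) = g x"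
    and TK: "\<And>u. norm (T u) \<le> K * norm u"
    by (rule ell1_extend[of g K, OF gK]) blast
  have T_add: "T (u + v) = T u + T v" and T_diff: "T (u - v) = T u - T v" for u v
    using bounded_clinear_bounded_linear[OF T] by (simp_all add: linear_add linear_diff bounded_linear.linear)
  have T_scaleC: "T (c *\<^sub>C u) = c *\<^sub>C T u" for c u
    using T by (simp add: bounded_clinear_def)
  have T_zero: "T 0 = 0" using T_diff[of 0 0] by simp
  have T_pre: "T (pre_tensor a b) = \<Phi> a b" for a b
  proof -
    have "T (pre_tensor a b) = (norm a * norm b) *\<^sub>R \<Phi> (sgn a) (sgn b)"
      unfolding pre_tensor_def T_scaleC Tg unfolding scaleC_of_real by (simp add: g_def)
    also have "\<dots> = \<Phi> (norm a *\<^sub>R sgn a) (norm b *\<^sub>R sgn b)"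
      by (simp only: scaleR_left scaleR_right scaleR_scaleR mult.commute)
    also have "\<dots> = \<Phi> a b"
      by (cases "a = 0"; cases "b = 0") (simp_all add: sgn_div_norm zero_left zero_right)
    finally show ?thesis .
  qed
  have hom: "\<Phi> (c *\<^sub>C a) b = c *\<^sub>C \<Phi> a b" "\<Phi> a (c *\<^sub>C b) = c *\<^sub>C \<Phi> a b" for c a b
    using \<Phi> by (simp_all add: bounded_cbilinear_def)
  have rel: "T u = 0" if "u \<in> tensor_relations" for u
    using that
  proof induction
    case (degenerate a b)
    then show ?case by (auto simp: Tg g_def zero_left zero_right)
  qed (simp_all add: T_add T_diff T_scaleC T_zero T_pre hom add_left add_right)
  have null: "T n = 0" if "n \<in> tensor_null" for n
  proof -
    obtain f where f: "\<And>k. f k \<in> tensor_relations" "f \<longlonglongrightarrow> n"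
      using \<open>n \<in> tensor_null\<close> unfolding tensor_null_def closure_sequential by blast
    have "(\<lambda>k. T (f k)) \<longlonglongrightarrow> T n"
      by (rule bounded_linear.tendsto[OF bounded_clinear_bounded_linear[OF T] f(2)])
    then show ?thesis
      using f(1) rel by (simp add: LIMSEQ_const_iff)
  qed
  define T' where "T' p = T (rep_ptensor p)" for p
  have T': "T' (ptensor_class u) = T u" for u
  proof -
    have "rep_ptensor (ptensor_class u) - u \<in> tensor_null"
      using ptensor_class_eq_iff Quotient3_abs_rep[OF Quotient3_ptensor] by metis
    from null[OF this] show ?thesis by (simp add: T'_def T_diff)
  qed
  have bound': "norm (T' p) \<le> K * norm p" for p
  proof -
    obtain u where p: "p = ptensor_class u" by (rule ptensor_cases)
    have "norm (T u) \<le> K * infdist u tensor_null + e" if "e > 0" for e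
    proof -
      have e: "e / (K + 1) > 0" using K \<open>e > 0\<close> by simp
      obtain n where n: "n \<in> tensor_null" "norm (u - n) < infdist u tensor_null + e / (K + 1)"
        using e by (rule infdist_tensor_null_approx)
      have "norm (T u) = norm (T (u - n))" by (simp add: T_diff null n)
      also have "\<dots> \<le> K * norm (u - n)" by (rule TK)
      also have "\<dots> \<le> K * (infdist u tensor_null + e / (K + 1))"
        using n K by (intro mult_left_mono) auto
      also have "\<dots> \<le> K * infdist u tensor_null + e"
        using K \<open>e > 0\<close> by (simp add: field_simps)
      finally show ?thesis .
    qed
    then show ?thesis
      by (simp add: p T' norm_ptensor.abs_eq field_le_epsilon)
  qed
  have "bounded_clinear T'"
  proof (rule bounded_clinearI[OF _ _ bound'])
    show "T' (p + q) = T' p + T' q" for p q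
      by (rule ptensor_cases[of p], rule ptensor_cases[of q]) (simp add: ptensor_class_plus T' T_add)
    show "T' (c *\<^sub>C p) = c *\<^sub>C T' p" for c p
      by (rule ptensor_cases[of p]) (simp add: ptensor_class_scaleC T' T_scaleC)
  qed
  then show ?thesis
    using bound' K by (intro exI[of _ "CBlinfun T'"])
      (auto simp: CBlinfun_apply tensor_def T' T_pre intro!: norm_CBlinfun_bound)
qed

definition ptensor_lift ::
  "('a::complex_normed_vector \<Rightarrow> 'b::complex_normed_vector \<Rightarrow> 'c::complex_banach) \<Rightarrow> ('a, 'b) ptensor \<Rightarrow>\<^sub>C\<^sub>L 'c" where
  "ptensor_lift \<Phi> = (THE T. \<forall>a b. cblinfun_apply T (a \<otimes>\<^sub>p b) = \<Phi> a b)"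

lemma ptensor_lift_apply:
  assumes "bounded_cbilinear \<Phi>"
  shows "cblinfun_apply (ptensor_lift \<Phi>) (a \<otimes>\<^sub>p b) = \<Phi> a b"
proof -
  have "bounded_bilinear \<Phi>" using assms by (simp add: bounded_cbilinear_def)
  from bounded_bilinear.pos_bounded[OF this] obtain K
    where "K > 0" "\<And>a b. norm (\<Phi> a b) \<le> K * (norm a * norm b)"
    by (auto simp: mult.commute)
  with ptensor_universal[OF assms, of K]
  obtain T where T: "\<forall>a b. cblinfun_apply T (a \<otimes>\<^sub>p b) = \<Phi> a b" by auto
  have "\<forall>a b. cblinfun_apply (ptensor_lift \<Phi>) (a \<otimes>\<^sub>p b) = \<Phi> a b"
    unfolding ptensor_lift_def by (rule theI[of _ T]) (auto simp: T intro: cblinfun_ptensor_eqI)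
  then show ?thesis by blast
qed


section \<open>Bimodules and Johnson pseudo-contractibility\<close>

definition ptensor_left :: "'a::complex_banach_algebra \<Rightarrow> ('a, 'a) ptensor \<Rightarrow>\<^sub>C\<^sub>L ('a, 'a) ptensor" where
  "ptensor_left a = ptensor_lift (\<lambda>b c. (a * b) \<otimes>\<^sub>p c)"

definition ptensor_right :: "'a::complex_banach_algebra \<Rightarrow> ('a, 'a) ptensor \<Rightarrow>\<^sub>C\<^sub>L ('a, 'a) ptensor" where
  "ptensor_right a = ptensor_lift (\<lambda>b c. b \<otimes>\<^sub>p (c * a))"

definition ptensor_mult :: "('a::complex_banach_algebra, 'a) ptensor \<Rightarrow>\<^sub>C\<^sub>L 'a" where
  "ptensor_mult = ptensor_lift (\<lambda>a b. a * b)"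

definition algebra_left :: "'a::complex_banach_algebra \<Rightarrow> 'a \<Rightarrow>\<^sub>C\<^sub>L 'a" where
  "algebra_left a = CBlinfun (\<lambda>x. a * x)"

definition algebra_right :: "'a::complex_banach_algebra \<Rightarrow> 'a \<Rightarrow>\<^sub>C\<^sub>L 'a" where
  "algebra_right a = CBlinfun (\<lambda>x. x * a)"

lemma ptensor_left_apply [simp]: "cblinfun_apply (ptensor_left a) (b \<otimes>\<^sub>p c) = (a * b) \<otimes>\<^sub>p c"
  unfolding ptensor_left_def
proof (rule ptensor_lift_apply, rule bounded_cbilinearI[where K = "norm a"])
  fix b c
  have "norm ((a * b) \<otimes>\<^sub>p c) \<le> norm (a * b) * norm c" by (rule norm_tensor_le)
  also have "\<dots> \<le> (norm a * norm b) * norm c"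
    by (intro mult_right_mono norm_mult_ineq) auto
  finally show "norm ((a * b) \<otimes>\<^sub>p c) \<le> norm a * (norm b * norm c)" by (simp add: mult.assoc)
qed (simp_all add: distrib_left mult_scaleC_right tensor_add_left tensor_add_right
      tensor_scaleC_left tensor_scaleC_right)

lemma ptensor_right_apply [simp]: "cblinfun_apply (ptensor_right a) (b \<otimes>\<^sub>p c) = b \<otimes>\<^sub>p (c * a)"
  unfolding ptensor_right_def
proof (rule ptensor_lift_apply, rule bounded_cbilinearI[where K = "norm a"])
  fix b c
  have "norm (b \<otimes>\<^sub>p (c * a)) \<le> norm b * norm (c * a)" by (rule norm_tensor_le)
  also have "\<dots> \<le> norm b * (norm c * norm a)"
    by (intro mult_left_mono norm_mult_ineq) auto
  finally show "norm (b \<otimes>\<^sub>p (c * a)) \<le> norm a * (norm b * norm c)" by (simp add: ac_simps)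
qed (simp_all add: distrib_right mult_scaleC_left tensor_add_left tensor_add_right
      tensor_scaleC_left tensor_scaleC_right)

lemma ptensor_mult_apply [simp]: "cblinfun_apply ptensor_mult (a \<otimes>\<^sub>p b) = a * b"
  unfolding ptensor_mult_def
  by (rule ptensor_lift_apply, rule bounded_cbilinearI[where K = 1])
    (simp_all add: distrib_left distrib_right mult_scaleC_left mult_scaleC_right norm_mult_ineq)

lemma algebra_left_apply [simp]: "cblinfun_apply (algebra_left a) x = a * x"
proof -
  have "bounded_clinear (\<lambda>x. a * x)"
    by (rule bounded_clinearI[where K = "norm a"])
      (simp_all add: distrib_left mult_scaleC_right norm_mult_ineq)
  then show ?thesis by (simp add: algebra_left_def CBlinfun_apply)
qed

lemma algebra_right_apply [simp]: "cblinfun_apply (algebra_right a) x = x * a"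
proof -
  have "bounded_clinear (\<lambda>x. x * a)"
    by (rule bounded_clinearI[where K = "norm a"])
      (simp_all add: distrib_right mult_scaleC_left norm_mult_ineq mult.commute[of "norm a"])
  then show ?thesis by (simp add: algebra_right_def CBlinfun_apply)
qed

text \<open>
  A bimodule \<open>X\<close> is given by its two families of operators \<open>left a = (x \<mapsto> a \<cdot> x)\<close> and
  \<open>right a = (x \<mapsto> x \<cdot> a)\<close>.  On the dual, \<open>(a \<cdot> f)(x) = f(x \<cdot> a)\<close> and \<open>(f \<cdot> a)(x) = f(a \<cdot> x)\<close>,
  so passing to the dual exchanges the two sides.
\<close>

definition dual_left ::
  "('a \<Rightarrow> 'x::complex_normed_vector \<Rightarrow>\<^sub>C\<^sub>L 'x) \<Rightarrow> 'a \<Rightarrow> 'x cdual \<Rightarrow>\<^sub>C\<^sub>L 'x cdual" where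
  "dual_left right a = cadjoint (right a)"

definition dual_right ::
  "('a \<Rightarrow> 'x::complex_normed_vector \<Rightarrow>\<^sub>C\<^sub>L 'x) \<Rightarrow> 'a \<Rightarrow> 'x cdual \<Rightarrow>\<^sub>C\<^sub>L 'x cdual" where
  "dual_right left a = cadjoint (left a)"

definition bidual_left ::
  "('a \<Rightarrow> 'x::complex_normed_vector \<Rightarrow>\<^sub>C\<^sub>L 'x) \<Rightarrow> 'a \<Rightarrow> 'x cdual cdual \<Rightarrow>\<^sub>C\<^sub>L 'x cdual cdual" where
  "bidual_left left = dual_left (dual_right left)"

definition bidual_right ::
  "('a \<Rightarrow> 'x::complex_normed_vector \<Rightarrow>\<^sub>C\<^sub>L 'x) \<Rightarrow> 'a \<Rightarrow> 'x cdual cdual \<Rightarrow>\<^sub>C\<^sub>L 'x cdual cdual" where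
  "bidual_right right = dual_right (dual_left right)"

text \<open>
  The net is rendered by a proper filter on the bidual: the eventuality filter of the net.  The
  two lemmas after the definition show that this is the same as the existence of a net in the
  literal sense, over a directed index set of any type.
\<close>

definition johnson_pseudo_contractible :: "'a::complex_banach_algebra itself \<Rightarrow> bool" where
  "johnson_pseudo_contractible (_ :: 'a itself) \<longleftrightarrow>
     (\<exists>F :: ('a, 'a) ptensor cdual cdual filter. F \<noteq> bot \<and>
        (\<forall>\<^sub>F m in F. \<forall>a. bidual_left ptensor_left a m = bidual_right ptensor_right a m) \<and>
        (\<forall>a. ((\<lambda>m. bidual_right algebra_right a (cadjoint (cadjoint ptensor_mult) m)
                  - canonical_embedding a) \<longlongrightarrow> 0) F))"

lemma johnson_pseudo_contractible_if_net:
  fixes I :: "'i set" and R :: "'i \<Rightarrow> 'i \<Rightarrow> bool"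
    and m :: "'i \<Rightarrow> ('a::complex_banach_algebra, 'a) ptensor cdual cdual"
  assumes directed: "I \<noteq> {}" "\<And>i j. i \<in> I \<Longrightarrow> j \<in> I \<Longrightarrow> \<exists>k\<in>I. R i k \<and> R j k"
    "\<And>i. i \<in> I \<Longrightarrow> R i i" "\<And>i j k. i \<in> I \<Longrightarrow> j \<in> I \<Longrightarrow> k \<in> I \<Longrightarrow> R i j \<Longrightarrow> R j k \<Longrightarrow> R i k"
    and comm: "\<And>i a. i \<in> I \<Longrightarrow> bidual_left ptensor_left a (m i) = bidual_right ptensor_right a (m i)"
    and lim: "\<And>a e. e > 0 \<Longrightarrow> \<exists>i\<in>I. \<forall>j\<in>I. R i j \<longrightarrow>
      norm (bidual_right algebra_right a (cadjoint (cadjoint ptensor_mult) (m j)) - canonical_embedding a) < e"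
  shows "johnson_pseudo_contractible TYPE('a)"
proof -
  define G where "G = (INF i\<in>I. principal {j\<in>I. R i j})"
  have G: "eventually P G \<longleftrightarrow> (\<exists>i\<in>I. \<forall>j\<in>I. R i j \<longrightarrow> P j)" for P
  proof -
    have "eventually P G \<longleftrightarrow> (\<exists>i\<in>I. eventually P (principal {j\<in>I. R i j}))"
      unfolding G_def
    proof (rule eventually_INF_base[OF directed(1)])
      fix i j assume ij: "i \<in> I" "j \<in> I"
      then obtain k where k: "k \<in> I" "R i k" "R j k" using directed(2) by blast
      then have "{l \<in> I. R k l} \<subseteq> {l \<in> I. R i l} \<inter> {l \<in> I. R j l}"
        using directed(4) ij by blast
      then show "\<exists>k\<in>I. principal {l \<in> I. R k l} \<le> inf (principal {l \<in> I. R i l}) (principal {l \<in> I. R j l})"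
        using k by auto
    qed
    then show ?thesis by (auto simp: eventually_principal)
  qed
  have "\<not> eventually (\<lambda>_. False) G"
    unfolding G using directed(3) by blast
  then have "filtermap m G \<noteq> bot"
    by (simp add: trivial_limit_def eventually_filtermap)
  moreover have "\<forall>\<^sub>F x in filtermap m G. \<forall>a. bidual_left ptensor_left a x = bidual_right ptensor_right a x"
    unfolding eventually_filtermap G using directed(1) comm by blast
  moreover have "((\<lambda>x. bidual_right algebra_right a (cadjoint (cadjoint ptensor_mult) x) - canonical_embedding a)
      \<longlongrightarrow> 0) (filtermap m G)" for a
    unfolding tendsto_iff eventually_filtermap G dist_norm diff_0_right using lim by blast
  ultimately show ?thesis
    unfolding johnson_pseudo_contractible_def by blast
qed

lemma net_if_johnson_pseudo_contractible:
  assumes "johnson_pseudo_contractible TYPE('a::complex_banach_algebra)"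
  shows "\<exists>(I :: (('a, 'a) ptensor cdual cdual \<times> ('a, 'a) ptensor cdual cdual set) set) R m.
    I \<noteq> {} \<and> (\<forall>i\<in>I. \<forall>j\<in>I. \<exists>k\<in>I. R i k \<and> R j k) \<and>
    (\<forall>i\<in>I. R i i) \<and> (\<forall>i\<in>I. \<forall>j\<in>I. \<forall>k\<in>I. R i j \<longrightarrow> R j k \<longrightarrow> R i k) \<and>
    (\<forall>i\<in>I. \<forall>a::'a. bidual_left ptensor_left a (m i) = bidual_right ptensor_right a (m i)) \<and>
    (\<forall>a::'a. \<forall>e>0. \<exists>i\<in>I. \<forall>j\<in>I. R i j \<longrightarrow>
      norm (bidual_right algebra_right a (cadjoint (cadjoint ptensor_mult) (m j)) - canonical_embedding a) < e)"
proof -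
  let ?d = "\<lambda>(a::'a) x. bidual_right algebra_right a (cadjoint (cadjoint ptensor_mult) x) - canonical_embedding a"
  obtain F :: "('a, 'a) ptensor cdual cdual filter" where F: "F \<noteq> bot"
    and comm: "\<forall>\<^sub>F m in F. \<forall>a. bidual_left ptensor_left a m = bidual_right ptensor_right a m"
    and lim: "\<And>a. ((\<lambda>x. ?d a x) \<longlongrightarrow> 0) F"
    using assms unfolding johnson_pseudo_contractible_def by blast
  define C where "C = {x :: ('a, 'a) ptensor cdual cdual.
    \<forall>a. bidual_left ptensor_left a x = bidual_right ptensor_right a x}"
  define I where "I = {(x, U). eventually (\<lambda>y. y \<in> U) F \<and> x \<in> U \<and> U \<subseteq> C}"
  define R where "R i j \<longleftrightarrow> snd j \<subseteq> snd i"
    for i j :: "('a, 'a) ptensor cdual cdual \<times> ('a, 'a) ptensor cdual cdual set"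
  have C: "eventually (\<lambda>y. y \<in> C) F"
    using comm by (simp add: C_def)
  have ex: "\<exists>x. (x, U \<inter> C) \<in> I" if "eventually (\<lambda>y. y \<in> U) F" for U
  proof -
    have "eventually (\<lambda>y. y \<in> U \<inter> C) F" using that C by (simp add: eventually_conj_iff)
    moreover from this obtain x where "x \<in> U \<inter> C" using F eventually_happens' by blast
    ultimately show ?thesis by (auto simp: I_def)
  qed
  have 1: "I \<noteq> {}" using ex[OF C] by blast
  have 2: "\<forall>i\<in>I. \<forall>j\<in>I. \<exists>k\<in>I. R i k \<and> R j k"
  proof (intro ballI)
    fix i j assume ij: "i \<in> I" "j \<in> I"
    have "eventually (\<lambda>y. y \<in> snd i \<inter> snd j) F"
      using ij by (auto simp: I_def eventually_conj_iff)
    from ex[OF this] obtain x where x: "(x, snd i \<inter> snd j \<inter> C) \<in> I" by blast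
    show "\<exists>k\<in>I. R i k \<and> R j k"
      by (rule bexI[OF _ x]) (auto simp: R_def)
  qed
  have 3: "\<forall>i\<in>I. R i i" and 4: "\<forall>i\<in>I. \<forall>j\<in>I. \<forall>k\<in>I. R i j \<longrightarrow> R j k \<longrightarrow> R i k"
    by (auto simp: R_def)
  have 5: "\<forall>i\<in>I. \<forall>a. bidual_left ptensor_left a (fst i) = bidual_right ptensor_right a (fst i)"
    unfolding I_def C_def by auto
  have 6: "\<forall>a. \<forall>e>0. \<exists>i\<in>I. \<forall>j\<in>I. R i j \<longrightarrow> norm (?d a (fst j)) < e"
  proof (intro allI impI)
    fix a and e :: real assume "e > 0"
    define U where "U = {x. norm (?d a x) < e}"
    have "eventually (\<lambda>x. x \<in> U) F"
      using tendstoD[OF lim \<open>e > 0\<close>, of a] by (simp add: U_def)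
    from ex[OF this] obtain x where x: "(x, U \<inter> C) \<in> I" by blast
    have "fst j \<in> U" if "j \<in> I" "R (x, U \<inter> C) j" for j
      using that by (auto simp: R_def I_def)
    then show "\<exists>i\<in>I. \<forall>j\<in>I. R i j \<longrightarrow> norm (?d a (fst j)) < e"
      by (intro bexI[OF _ x]) (simp add: U_def)
  qed
  show ?thesis
    by (rule exI[of _ I], rule exI[of _ R], rule exI[of _ fst]) (intro conjI 1 2 3 4 5 6)
qed

end

theory Submission
  imports Defs
begin

text \<open>
  Since \<open>\<ell>\<^sup>1(S)\<close> has the unit \<open>\<delta>\<^sub>1\<close>, some commuting \<open>m\<close> satisfies \<open>\<parallel>\<pi>\<^sup>*\<^sup>*(m) - \<delta>\<^sub>1\<parallel> < 1/2\<close>.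
  Evaluated on indicator functions, \<open>m\<close> is a bounded finitely additive measure \<open>\<mu>\<close> on \<open>S \<times> S\<close>.
  For \<open>A = {(x, y). xy = s, x \<in> sS}\<close>, commutation with \<open>\<delta>\<^sub>s\<close> turns \<open>\<mu>{(x, y). sxy = s}\<close>, which is
  at least \<open>1/2\<close> in modulus, into \<open>\<mu>{(x, y). xys = s, x \<in> sS}\<close>.  So this set is nonempty, which makes
  \<open>s\<close> regular, and all its elements satisfy \<open>xS = sS\<close>.  As \<open>\<mu>\<close> is bounded there are
  only finitely many principal right ideals, and dually finitely many principal left ideals; an
  idempotent \<open>e\<close> is determined by \<open>eS\<close> and \<open>Se\<close>.
\<close>

section \<open>Bounded functions on S x T as functionals on the projective tensor product\<close>

text \<open>Point masses determine bounded linear maps on each \<ell>^1 factor, so they can replace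
  general elementary tensors one variable at a time. Every later identity between functionals is
  checked this way.\<close>

lemma cdual_ptensor_ell1_eqI:
  fixes F G :: "('s ell1, 't ell1) ptensor cdual"
  assumes "\<And>x y. F (ell1_delta x \<otimes>\<^sub>p ell1_delta y) = G (ell1_delta x \<otimes>\<^sub>p ell1_delta y)"
  shows "F = G"
proof (rule cblinfun_ptensor_eqI)
  have norm_le: "norm (H (u \<otimes>\<^sub>p v)) \<le> norm H * (norm u * norm v)"
    for H :: "('s ell1, 't ell1) ptensor cdual" and u v
    using norm_cblinfun[of H "u \<otimes>\<^sub>p v"] mult_left_mono[OF norm_tensor_le[of u v] norm_ge_zero[of H]]
    by linarith
  have left: "bounded_clinear (\<lambda>u. H (u \<otimes>\<^sub>p v))" for H :: "('s ell1, 't ell1) ptensor cdual" and v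
    by (rule bounded_clinearI[where K = "norm H * norm v"])
      (use norm_le[of H _ v] in \<open>simp_all add: tensor_add_left tensor_scaleC_left ac_simps\<close>)
  have right: "bounded_clinear (\<lambda>v. H (u \<otimes>\<^sub>p v))" for H :: "('s ell1, 't ell1) ptensor cdual" and u
    by (rule bounded_clinearI[where K = "norm H * norm u"])
      (use norm_le[of H u] in \<open>simp_all add: tensor_add_right tensor_scaleC_right ac_simps\<close>)
  have "F (ell1_delta x \<otimes>\<^sub>p v) = G (ell1_delta x \<otimes>\<^sub>p v)" for x v
    by (rule ell1_clinear_eqI[OF right right assms])
  then show "F (u \<otimes>\<^sub>p v) = G (u \<otimes>\<^sub>p v)" for u v
    by (rule ell1_clinear_eqI[OF left left])
qed

text \<open>Together with the previous lemma this identifies the dual with the bounded functions on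
  the product. The kernel is extended twice: \<open>T x\<close> extends \<phi>(x, .) in the second
  variable, then \<open>B v\<close> extends x \<mapsto> T x v in the first.\<close>

lemma cdual_ptensor_ell1_exists:
  fixes \<phi> :: "'s \<times> 't \<Rightarrow> complex"
  assumes \<phi>: "\<And>p. norm (\<phi> p) \<le> K"
  obtains F :: "('s ell1, 't ell1) ptensor cdual"
  where "\<And>x y. F (ell1_delta x \<otimes>\<^sub>p ell1_delta y) = \<phi> (x, y)" "norm F \<le> K"
proof -
  have "\<forall>x. \<exists>T. bounded_clinear T \<and> (\<forall>y. T (ell1_delta y) = \<phi> (x, y)) \<and> (\<forall>v. norm (T v) \<le> K * norm v)"
    using ell1_extend[of "\<lambda>y. \<phi> (x, y)" K for x] \<phi> by metis
  then obtain T where T: "\<And>x. bounded_clinear (T x)" "\<And>x y. T x (ell1_delta y) = \<phi> (x, y)"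
      "\<And>x v. norm (T x v) \<le> K * norm v"
    by metis
  have "\<forall>v. \<exists>B. bounded_clinear B \<and> (\<forall>x. B (ell1_delta x) = T x v) \<and> (\<forall>u. norm (B u) \<le> K * norm v * norm u)"
    using ell1_extend[of "\<lambda>x. T x v" "K * norm v" for v] T(3) by metis
  then obtain B where B: "\<And>v. bounded_clinear (B v)" "\<And>v x. B v (ell1_delta x) = T x v"
      "\<And>v u. norm (B v u) \<le> K * norm v * norm u"
    by metis
  have T_add: "T x (v + w) = T x v + T x w" and T_scaleC: "T x (c *\<^sub>C v) = c *\<^sub>C T x v" for x v w c
    using T(1)[of x] by (auto simp: bounded_clinear_def linear_add[OF bounded_linear.linear])
  have B_add: "B v (u + w) = B v u + B v w" and B_scaleC: "B v (c *\<^sub>C u) = c *\<^sub>C B v u" for u v w c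
    using B(1)[of v] by (auto simp: bounded_clinear_def linear_add[OF bounded_linear.linear])
  have "bounded_cbilinear (\<lambda>u v. B v u)"
  proof (rule bounded_cbilinearI[where K = K])
    \<comment> \<open>Linearity in the parameter \<open>v\<close> is not built into
      \<open>B\<close>: both sides are bounded linear in \<open>u\<close>, and on point masses the
      claim is linearity of \<open>T x\<close>.\<close>
    show "B (v + w) u = B v u + B w u" for u v w
      by (rule ell1_clinear_eqI[of "B (v + w)" "\<lambda>u. B v u + B w u"])
        (simp_all add: B(1,2) bounded_clinear_add T_add)
    show "B (c *\<^sub>C v) u = c *\<^sub>C B v u" for c u v
      by (rule ell1_clinear_eqI[of "B (c *\<^sub>C v)" "\<lambda>u. c *\<^sub>C B v u"])
        (simp_all add: B(1,2) bounded_clinear_scaleC T_scaleC)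
    show "norm (B v u) \<le> K * (norm u * norm v)" for u v
      using B(3)[of v u] by (simp add: ac_simps)
  qed (simp_all add: B_add B_scaleC)
  moreover have "norm (B v u) \<le> K * (norm u * norm v)" for u v
    using B(3)[of v u] by (simp add: ac_simps)
  moreover have "0 \<le> K"
    using \<phi>[of undefined] norm_ge_zero order_trans by blast
  ultimately obtain F :: "('s ell1, 't ell1) ptensor cdual" where
    "\<And>u v. F (u \<otimes>\<^sub>p v) = B v u" "norm F \<le> K"
    using ptensor_universal[of "\<lambda>u v. B v u" K] by blast
  then show thesis
    using that[of F] by (simp add: B(2) T(2))
qed

text \<open>For bounded \<phi> the choice is unique, by the two lemmas above; for unbounded \<phi>
  no such functional exists and the value is arbitrary.\<close>

definition ell1_form :: "('s \<times> 't \<Rightarrow> complex) \<Rightarrow> ('s ell1, 't ell1) ptensor cdual" where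
  "ell1_form \<phi> = (SOME F. \<forall>x y. cblinfun_apply F (ell1_delta x \<otimes>\<^sub>p ell1_delta y) = \<phi> (x, y))"

lemma
  assumes "\<And>p. norm (\<phi> p) \<le> K"
  shows ell1_form_delta: "ell1_form \<phi> (ell1_delta x \<otimes>\<^sub>p ell1_delta y) = \<phi> (x, y)"
    and norm_ell1_form_le: "norm (ell1_form \<phi>) \<le> K"
proof -
  obtain F where F: "\<And>x y. cblinfun_apply F (ell1_delta x \<otimes>\<^sub>p ell1_delta y) = \<phi> (x, y)" "norm F \<le> K"
    by (rule cdual_ptensor_ell1_exists[of \<phi> K, OF assms]) (rule that)
  have form: "ell1_form \<phi> (ell1_delta x \<otimes>\<^sub>p ell1_delta y) = \<phi> (x, y)" for x y
    using someI[of "\<lambda>F. \<forall>x y. cblinfun_apply F (ell1_delta x \<otimes>\<^sub>p ell1_delta y) = \<phi> (x, y)" F] F(1)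
    by (simp add: ell1_form_def)
  then show "ell1_form \<phi> (ell1_delta x \<otimes>\<^sub>p ell1_delta y) = \<phi> (x, y)" .
  have "ell1_form \<phi> = F"
    by (rule cdual_ptensor_ell1_eqI) (simp add: form F(1))
  with F(2) show "norm (ell1_form \<phi>) \<le> K" by simp
qed

section \<open>The finitely additive measure of a bidual element\<close>

definition pair_measure ::
  "('s ell1, 't ell1) ptensor cdual cdual \<Rightarrow> ('s \<times> 't) set \<Rightarrow> complex" where
  "pair_measure m A = m (ell1_form (indicator A))"

lemma norm_indicator_complex_le: "norm (indicator A p :: complex) \<le> 1"
  by (simp add: indicator_def)

lemmas ell1_form_indicator = ell1_form_delta[OF norm_indicator_complex_le]

lemma pair_measure_empty [simp]: "pair_measure m {} = 0"
proof -
  have "ell1_form (indicator {} :: 'a \<times> 'b \<Rightarrow> complex) = 0"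
    by (rule cdual_ptensor_ell1_eqI) (simp add: ell1_form_indicator zero_cblinfun.rep_eq)
  then show ?thesis
    by (simp add: pair_measure_def linear_0[OF bounded_linear.linear[OF bounded_linear_cblinfun_apply]])
qed

text \<open>This bounds the total variation by \<open>norm m\<close>. With phases \<open>c i\<close>
  rotating each value onto its modulus, the left side is \<open>m\<close> applied to the step
  function \<phi>, which is bounded by 1 because the sets are disjoint.\<close>

lemma sum_norm_pair_measure_le:
  fixes m :: "('s ell1, 't ell1) ptensor cdual cdual"
    and I :: "'i set"
  assumes "finite I" "disjoint_family_on A I"
  shows "(\<Sum>i\<in>I. norm (pair_measure m (A i))) \<le> norm m"
proof -
  define c where "c i = cnj (sgn (pair_measure m (A i)))" for i
  define \<phi> where "\<phi> p = (\<Sum>i\<in>I. c i * indicator (A i) p)" for p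
  have sgn: "cnj (sgn z) * z = of_real (norm z)" for z
  proof (cases "z = 0")
    case False
    have "cnj (sgn z) * z = z * cnj z / of_real (norm z)"
      by (simp add: sgn_eq)
    also have "\<dots> = of_real (norm z)"
      using False unfolding complex_norm_square[symmetric] by (simp add: power2_eq_square)
    finally show ?thesis .
  qed simp
  have c: "norm (c i) \<le> 1" "c i * pair_measure m (A i) = of_real (norm (pair_measure m (A i)))" for i
    by (simp add: c_def norm_sgn) (simp add: c_def sgn)
  have \<phi>: "norm (\<phi> p) \<le> 1" for p
  proof (cases "\<exists>i\<in>I. p \<in> A i")
    case True
    then obtain i where i: "i \<in> I" "p \<in> A i" by blast
    \<comment> \<open>The point \<open>p\<close> lies in no other set of the family, so only one
      term survives.\<close>
    then have "\<phi> p = (\<Sum>j\<in>{i}. c j * indicator (A j) p)"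
      unfolding \<phi>_def using assms
      by (intro sum.mono_neutral_right) (auto simp: disjoint_family_on_def indicator_def)
    with i c(1)[of i] show ?thesis by simp
  next
    case False
    then show ?thesis by (simp add: \<phi>_def sum.neutral)
  qed
  have apply_sum: "(\<Sum>i\<in>I. g i) x = (\<Sum>i\<in>I. g i x)"
    for g :: "'i \<Rightarrow> ('s ell1, 't ell1) ptensor cdual" and x
    by (induction I rule: infinite_finite_induct) (simp_all add: zero_cblinfun.rep_eq)
  have "ell1_form \<phi> = (\<Sum>i\<in>I. c i *\<^sub>C ell1_form (indicator (A i)))"
    by (rule cdual_ptensor_ell1_eqI)
      (simp add: apply_sum ell1_form_delta[OF \<phi>] ell1_form_indicator \<phi>_def scaleC_complex_def)
  then have "m (ell1_form \<phi>) = (\<Sum>i\<in>I. c i * pair_measure m (A i))"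
    by (simp add: linear_sum[OF bounded_linear.linear[OF bounded_linear_cblinfun_apply]]
        pair_measure_def scaleC_complex_def)
  also have "\<dots> = of_real (\<Sum>i\<in>I. norm (pair_measure m (A i)))"
    by (simp add: c(2))
  finally have "(\<Sum>i\<in>I. norm (pair_measure m (A i))) = norm (m (ell1_form \<phi>))"
    by (simp only: norm_of_real) (simp add: sum_nonneg)
  also have "\<dots> \<le> norm m * norm (ell1_form \<phi>)"
    by (rule norm_cblinfun)
  also have "\<dots> \<le> norm m"
    using norm_ell1_form_le[of \<phi> 1, OF \<phi>] by (simp add: mult_left_le)
  finally show ?thesis .
qed

text \<open>The label \<open>g\<close> recovers the index from any point of \<open>A i\<close>, so
  the sets are disjoint. Each contributes at least \<open>d\<close> to a total variation of at most
  \<open>norm m\<close>, whence at most \<open>norm m / d\<close> indices.\<close>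

lemma finite_if_pair_measure_ge:
  fixes m :: "('s ell1, 't ell1) ptensor cdual cdual"
  assumes "d > 0" "\<And>i. i \<in> I \<Longrightarrow> d \<le> norm (pair_measure m (A i))"
    and label: "\<And>i x y. i \<in> I \<Longrightarrow> (x, y) \<in> A i \<Longrightarrow> g x y = i"
  shows "finite I"
proof (rule finite_if_finite_subsets_card_bdd[THEN conjunct1])
  fix J assume J: "J \<subseteq> I" "finite J"
  have "real (card J) * d \<le> (\<Sum>i\<in>J. norm (pair_measure m (A i)))"
    using assms(2) J by (intro sum_bounded_below) auto
  also have "\<dots> \<le> norm m"
  proof (rule sum_norm_pair_measure_le[OF J(2)])
    have "i = j" if "i \<in> J" "j \<in> J" "p \<in> A i" "p \<in> A j" for i j p
      using label[of i "fst p" "snd p"] label[of j "fst p" "snd p"] that J(1) by auto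
    then show "disjoint_family_on A J"
      by (auto simp: disjoint_family_on_def)
  qed
  finally have "real (card J) \<le> norm m / d"
    using assms(1) by (simp add: field_simps)
  then show "card J \<le> nat \<lfloor>norm m / d\<rfloor>"
    by (simp add: le_nat_floor)
qed

section \<open>What commutation and the approximate unit condition say about the measure\<close>

text \<open>The adjoints of the two actions of \<delta>_s pull a function \<phi> back to \<phi>(sx,
  y) and \<phi>(x, ys). The claim is the commutation hypothesis tested on the indicator of
  \<open>A\<close>.\<close>

lemma pair_measure_commute:
  fixes m :: "('s::semigroup_mult ell1, 's ell1) ptensor cdual cdual"
  assumes "bidual_left ptensor_left (ell1_delta s) m = bidual_right ptensor_right (ell1_delta s) m"
  shows "pair_measure m {(x, y). (s * x, y) \<in> A} = pair_measure m {(x, y). (x, y * s) \<in> A}"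
proof -
  let ?F = "ell1_form (indicator A)"
  have "cadjoint (ptensor_left (ell1_delta s)) ?F = ell1_form (indicator {(x, y). (s * x, y) \<in> A})"
    by (rule cdual_ptensor_ell1_eqI)
      (simp add: ell1_form_indicator ell1_delta_mult indicator_def)
  moreover have "cadjoint (ptensor_right (ell1_delta s)) ?F = ell1_form (indicator {(x, y). (x, y * s) \<in> A})"
    by (rule cdual_ptensor_ell1_eqI)
      (simp add: ell1_form_indicator ell1_delta_mult indicator_def)
  moreover have "m (cadjoint (ptensor_left (ell1_delta s)) ?F) = m (cadjoint (ptensor_right (ell1_delta s)) ?F)"
    using arg_cong[OF assms, of "\<lambda>X. cblinfun_apply X ?F"]
    by (simp add: bidual_left_def bidual_right_def dual_left_def dual_right_def)
  ultimately show ?thesis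
    by (simp add: pair_measure_def)
qed

text \<open>The indicator of \<open>B\<close> defines a functional \<open>f\<close> of norm at most
  1 on \<ell>^1(S). Pulled back along multiplication it is the indicator of xy \<in> B, and it takes
  the value 1 at \<delta>_1, so the measure differs from 1 by at most \<open>e\<close>.\<close>

lemma norm_pair_measure_mult_ge:
  fixes m :: "('s::monoid_mult ell1, 's ell1) ptensor cdual cdual"
  assumes m: "norm (bidual_right algebra_right (ell1_delta 1) (cadjoint (cadjoint ptensor_mult) m)
      - canonical_embedding (ell1_delta 1)) \<le> e"
    and "1 \<in> B"
  shows "1 - e \<le> norm (pair_measure m {(x, y). x * y \<in> B})"
proof -
  let ?D = "bidual_right algebra_right (ell1_delta 1) (cadjoint (cadjoint ptensor_mult) m)
      - canonical_embedding (ell1_delta 1)"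
  obtain T where T: "bounded_clinear T" "\<And>x. T (ell1_delta x) = (indicator B x :: complex)"
      "\<And>u. norm (T u) \<le> 1 * norm u"
    by (rule ell1_extend[of "indicator B :: 's \<Rightarrow> complex" 1, OF norm_indicator_complex_le]) (rule that)
  define f where "f = CBlinfun T"
  have f: "cblinfun_apply f = T" "norm f \<le> 1"
    unfolding f_def using T by (auto simp: CBlinfun_apply intro: norm_CBlinfun_bound)
  have "cadjoint ptensor_mult (cadjoint (algebra_right (ell1_delta 1)) f)
      = ell1_form (indicator {(x, y). x * y \<in> B})"
    by (rule cdual_ptensor_ell1_eqI)
      (simp add: ell1_form_indicator ell1_delta_mult f T indicator_def)
  then have "?D f = pair_measure m {(x, y). x * y \<in> B} - 1"
    using assms(2)
    by (simp add: minus_cblinfun.rep_eq bidual_right_def dual_left_def dual_right_def pair_measure_def f T)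
  moreover have "norm (?D f) \<le> norm ?D * norm f"
    by (rule norm_cblinfun)
  moreover have "norm ?D * norm f \<le> e * 1"
    using m f(2) by (intro mult_mono) (auto intro: order_trans[OF norm_ge_zero])
  ultimately have "norm (1 - pair_measure m {(x, y). x * y \<in> B}) \<le> e"
    by (simp add: norm_minus_commute)
  then show ?thesis
    using norm_triangle_ineq2[of 1 "pair_measure m {(x, y). x * y \<in> B}"] by simp
qed

section \<open>Regular elements, principal one-sided ideals and idempotents\<close>

lemma von_neumann_regular:
  fixes s :: "'s::semigroup_mult"
  assumes "s * t * s = s"
  shows "\<exists>t. s * t * s = s \<and> t * s * t = t"
\<comment> \<open>The witness is \<open>t * s * t\<close>.\<close>
proof (intro exI conjI)
  have *: "s * (t * (s * z)) = s * z" for z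
    using arg_cong[OF assms, of "\<lambda>x. x * z"] by (simp add: mult.assoc)
  show "s * (t * s * t) * s = s" "(t * s * t) * s * (t * s * t) = t * s * t"
    using assms by (simp_all add: mult.assoc *)
qed

text \<open>The hypotheses place \<open>x\<close> and \<open>s\<close> in one R-class in the sense
  of Green; the dual for L-classes follows.\<close>

lemma range_mult_left_eqI:
  fixes s :: "'s::semigroup_mult"
  assumes "x = s * a" "s = x * b"
  shows "range ((*) x) = range ((*) s)"
proof (intro equalityI subsetI)
  show "z \<in> range ((*) s)" if "z \<in> range ((*) x)" for z
    using that assms(1) by (auto simp: mult.assoc)
  show "z \<in> range ((*) x)" if "z \<in> range ((*) s)" for z
  proof -
    from that obtain w where "z = s * w" by blast
    then have "z = x * (b * w)" by (subst (asm) assms(2)) (simp add: mult.assoc)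
    then show ?thesis by blast
  qed
qed

lemma range_mult_right_eqI:
  fixes s :: "'s::semigroup_mult"
  assumes "x = a * s" "s = b * x"
  shows "range (\<lambda>z. z * x) = range (\<lambda>z. z * s)"
proof (intro equalityI subsetI)
  show "z \<in> range (\<lambda>z. z * s)" if "z \<in> range (\<lambda>z. z * x)" for z
    using that assms(1) by (auto simp: mult.assoc[symmetric])
  show "z \<in> range (\<lambda>z. z * x)" if "z \<in> range (\<lambda>z. z * s)" for z
  proof -
    from that obtain w where "z = w * s" by blast
    then have "z = (w * b) * x" by (subst (asm) assms(2)) (simp add: mult.assoc)
    then show ?thesis by blast
  qed
qed

text \<open>An idempotent \<open>e\<close> is a left identity on eS, which contains
  \<open>f\<close>, and \<open>f\<close> is a right identity on Sf, which contains \<open>e\<close>;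
  so \<open>e * f\<close> equals both.\<close>

lemma idempotent_eqI:
  fixes e f :: "'s::monoid_mult"
  assumes "e * e = e" "f * f = f" "range ((*) e) = range ((*) f)" "range (\<lambda>x. x * e) = range (\<lambda>x. x * f)"
  shows "e = f"
proof -
  have "f \<in> range ((*) e)" "e \<in> range (\<lambda>x. x * f)"
    using assms(3,4) rangeI[of "(*) f" 1] rangeI[of "\<lambda>x. x * e" 1] by simp_all
  then obtain a b where a: "f = e * a" and b: "e = b * f" by blast
  have "e * f = f"
    unfolding a mult.assoc[symmetric] assms(1) ..
  moreover have "e * f = e"
    by (subst (1 2) b) (simp add: mult.assoc assms(2))
  ultimately show ?thesis by simp
qed

theorem corollary2p4:
  assumes "johnson_pseudo_contractible TYPE('s::monoid_mult ell1)"
  shows "(\<forall>s::'s. \<exists>t. s * t * s = s \<and> t * s * t = t) \<and> finite {e::'s. e * e = e}"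
proof -
  let ?D = "\<lambda>m :: ('s ell1, 's ell1) ptensor cdual cdual.
    bidual_right algebra_right (ell1_delta 1) (cadjoint (cadjoint ptensor_mult) m)
      - canonical_embedding (ell1_delta 1)"
  obtain F :: "('s ell1, 's ell1) ptensor cdual cdual filter" where F: "F \<noteq> bot"
    and comm: "\<forall>\<^sub>F m in F. \<forall>a. bidual_left ptensor_left a m = bidual_right ptensor_right a m"
    and lim: "(?D \<longlongrightarrow> 0) F"
    using assms unfolding johnson_pseudo_contractible_def by blast
  have "\<forall>\<^sub>F m in F. norm (?D m) < 1 / 2"
    using tendstoD[OF lim, of "1 / 2"] by simp
  with comm have "\<forall>\<^sub>F m in F. (\<forall>a. bidual_left ptensor_left a m = bidual_right ptensor_right a m)
      \<and> norm (?D m) < 1 / 2"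
    by (rule eventually_conj)
  \<comment> \<open>One member of the net suffices from here on: finiteness uses only the norm of
    this \<open>m\<close>, so the net may be unbounded.\<close>
  then obtain m where m: "\<And>a. bidual_left ptensor_left a m = bidual_right ptensor_right a m"
    and "norm (?D m) < 1 / 2"
    using eventually_happens'[OF F] by blast
  then have unit: "1 / 2 \<le> norm (pair_measure m {(x, y). x * y \<in> B})" if "1 \<in> B" for B
    using norm_pair_measure_mult_ge[of m "1 / 2" B] that by simp
  define P where "P s = {(x, y). x * y * s = s \<and> x \<in> range ((*) s)}" for s :: 's
  define Q where "Q s = {(x, y). s * (x * y) = s \<and> y \<in> range (\<lambda>z. z * s)}" for s :: 's
  \<comment> \<open>Substituting \<open>s * x\<close> for \<open>x\<close> makes membership in sS
    automatic, leaving s(xy) = s, that is xy \<in> B with 1 \<in> B. Substituting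
    \<open>y * s\<close> for \<open>y\<close> instead gives \<open>P s\<close>.\<close>
  have P: "1 / 2 \<le> norm (pair_measure m (P s))" for s
    using pair_measure_commute[OF m, of s "{(x, y). x * y = s \<and> x \<in> range ((*) s)}"]
      unit[of "{z. s * z = s}"]
    by (simp add: P_def mult.assoc)
  \<comment> \<open>The mirror image: here \<open>y * s\<close> satisfies the ideal condition
    automatically, and substituting \<open>s * x\<close> for \<open>x\<close> gives
    \<open>Q s\<close>.\<close>
  have Q: "1 / 2 \<le> norm (pair_measure m (Q s))" for s
    using pair_measure_commute[OF m, of s "{(x, y). x * y = s \<and> y \<in> range (\<lambda>z. z * s)}"]
      unit[of "{z. z * s = s}"]
    by (simp add: Q_def mult.assoc)
  have regular: "\<exists>t. s * t * s = s \<and> t * s * t = t" for s :: 's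
  proof -
    \<comment> \<open>The empty set has measure 0, below 1/2.\<close>
    have "P s \<noteq> {}"
      using P[of s] by force
    then obtain a y where "s * a * y * s = s"
      by (auto simp: P_def)
    then have "s * (a * y) * s = s"
      by (simp add: mult.assoc)
    then show ?thesis by (rule von_neumann_regular)
  qed
  have P_ideal: "range ((*) x) = range ((*) s)" if "(x, y) \<in> P s" for x y s
  proof -
    from that obtain a where "x = s * a" "s = x * (y * s)"
      by (auto simp: P_def mult.assoc)
    then show ?thesis by (rule range_mult_left_eqI)
  qed
  have Q_ideal: "range (\<lambda>z. z * y) = range (\<lambda>z. z * s)" if "(x, y) \<in> Q s" for x y s
  proof -
    from that obtain a where "y = a * s" "s = (s * x) * y"
      by (auto simp: Q_def mult.assoc)
    then show ?thesis by (rule range_mult_right_eqI)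
  qed
  let ?R = "\<lambda>s::'s. range ((*) s)" and ?L = "\<lambda>s::'s. range (\<lambda>z. z * s)"
  have "finite (range ?R)"
  \<comment> \<open>Each right ideal \<open>r\<close> is represented by one chosen generator
    \<open>inv ?R r\<close>; the label of a pair \<open>(x, y)\<close> is xS, which equals
    \<open>r\<close> by \<open>P_ideal\<close>.\<close>
  proof (rule finite_if_pair_measure_ge[where A = "\<lambda>r. P (inv ?R r)", OF _ P])
    show "?R x = r" if "r \<in> range ?R" "(x, y) \<in> P (inv ?R r)" for r x y
      using P_ideal[OF that(2)] f_inv_into_f[OF that(1)] by (rule trans)
  qed simp
  moreover have "finite (range ?L)"
  proof (rule finite_if_pair_measure_ge[where A = "\<lambda>l. Q (inv ?L l)", OF _ Q])
    show "?L y = l" if "l \<in> range ?L" "(x, y) \<in> Q (inv ?L l)" for l x y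
      using Q_ideal[OF that(2)] f_inv_into_f[OF that(1)] by (rule trans)
  qed simp
  ultimately have fin: "finite (range ?R \<times> range ?L)" by simp
  have "inj_on (\<lambda>e. (?R e, ?L e)) {e. e * e = e}"
    by (rule inj_onI, rule idempotent_eqI) simp_all
  then have "finite {e::'s. e * e = e}"
    by (rule inj_on_finite[OF _ _ fin]) blast
  with regular show ?thesis by blast
qed

end
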